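(* Let $\varphi\in H^\infty_1(\mathbb{D}^2)$ be non-constant. Then the de Branges-Rovnyak space $\mathcal{H}(\mathcal{S}_2^\varphi)$ is a CNP space if and only if there exist $\mu\in\mathbb{D}$, $\lambda\in\mathbb{T}$ and $i\in\{1,2\}$ such that $\varphi(z_1,z_2)=\lambda\, b_\mu(z_i)$ for all $(z_1,z_2)\in\mathbb{D}^2$.
   Context: $\mathbb{D}$ is the open unit disc in $\mathbb{C}$, $\mathbb{T}=\{z\in\mathbb{C}:|z|=1\}$, and for $\mu\in\mathbb{D}$, $b_\mu(z)=\frac{z-\mu}{1-\bar\mu z}$ is the corresponding automorphism of $\mathbb{D}$. $H^\infty_1(\mathbb{D}^2)$ is the set of holomorphic functions $\varphi:\mathbb{D}^2\to\mathbb{C}$ with $\sup|\varphi|\le1$. $\mathcal{S}_2$ is the Szegő kernel of the Hardy space $H^2(\mathbb{D}^2)$ on the bidisc, $$\mathcal{S}_2(\boldsymbol z,\boldsymbol w)=\frac{1}{(1-z_1\overline{w_1})(1-z_2\overline{w_2})}\quad(\boldsymbol z=(z_1,z_2),\ \boldsymbol w=(w_1,w_2)\in\mathbb{D}^2).$$ The space $\mathcal{H}(\mathcal{S}_2^\varphi)$ is the reproducing kernel Hilbert space on $\mathbb{D}^2$ with kernel $\mathcal{S}_2^\varphi(\boldsymbol z,\boldsymbol w)=(1-\varphi(\boldsymbol z)\overline{\varphi(\boldsymbol w)})\,\mathcal{S}_2(\boldsymbol z,\boldsymbol w)$. A kernel (positive semi-definite function) $K$ on a set $\Omega$, with reproducing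 kernel Hilbert space $\mathcal{H}(K)$, is a complete Nevanlinna-Pick (CNP) kernel, and $\mathcal{H}(K)$ a CNP space, if for all $m,n\in\mathbb{N}$, every finite set of distinct points $x_1,\dots,x_k\in\Omega$ and all complex $m\times n$ matrices $W_1,\dots,W_k$ for which the block matrix $[(I-W_iW_j^* )K(x_i,x_j)]_{i,j=1}^k$ is positive semi-definite, there is a function $\Phi$ from $\Omega$ to the $m\times n$ matrices, multiplying $\mathcal{H}(K)\otimes\mathbb{C}^n$ into $\mathcal{H}(K)\otimes\mathbb{C}^m$, with $\Phi(x_i)=W_i$ for all $i$ and multiplication operator satisfying $\|M_\Phi\|\le1$. *)

theory Defs
  imports "HOL-Analysis.Analysis" "Jordan_Normal_Form.Schur_Decomposition"
begin

definition psd_mat :: "complex mat \<Rightarrow> bool" where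
  "psd_mat A \<longleftrightarrow> square_mat A \<and> (\<forall>v \<in> carrier_vec (dim_row A). 0 \<le> (A *\<^sub>v v) \<bullet>c v)"

definition psd_kernel :: "'a set \<Rightarrow> ('a \<Rightarrow> 'a \<Rightarrow> complex) \<Rightarrow> bool" where
  "psd_kernel \<Omega> K \<longleftrightarrow>
     (\<forall>k (x :: nat \<Rightarrow> 'a). inj_on x {..<k} \<and> x ` {..<k} \<subseteq> \<Omega> \<longrightarrow>
        psd_mat (Matrix.mat k k (\<lambda>(i, j). K (x i) (x j))))"

text \<open>
  A Hilbert space of functions on \<open>\<Omega>\<close> is given by its carrier \<open>H\<close> and its inner product \<open>ip\<close>,
  which is linear in the first argument. A function on \<open>\<Omega>\<close> is represented by its extension by 0
  to the whole type, so that equality of elements of \<open>H\<close> is equality of functions on \<open>\<Omega>\<close>. The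
  values of \<open>ip\<close> outside \<open>H\<close> are irrelevant.
\<close>

definition ip_norm :: "(('a \<Rightarrow> complex) \<Rightarrow> ('a \<Rightarrow> complex) \<Rightarrow> complex) \<Rightarrow> ('a \<Rightarrow> complex) \<Rightarrow> real" where
  "ip_norm ip f = sqrt (Re (ip f f))"

locale hilbert_function_space =
  fixes \<Omega> :: "'a set"
    and H :: "('a \<Rightarrow> complex) set"
    and ip :: "('a \<Rightarrow> complex) \<Rightarrow> ('a \<Rightarrow> complex) \<Rightarrow> complex"
  assumes supported: "f \<in> H \<Longrightarrow> x \<notin> \<Omega> \<Longrightarrow> f x = 0"
    and zero_mem: "(\<lambda>x. 0) \<in> H"
    and add_mem: "f \<in> H \<Longrightarrow> g \<in> H \<Longrightarrow> (\<lambda>x. f x + g x) \<in> H"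
    and scale_mem: "f \<in> H \<Longrightarrow> (\<lambda>x. c * f x) \<in> H"
    and ip_add: "f \<in> H \<Longrightarrow> g \<in> H \<Longrightarrow> h \<in> H \<Longrightarrow> ip (\<lambda>x. f x + g x) h = ip f h + ip g h"
    and ip_scale: "f \<in> H \<Longrightarrow> g \<in> H \<Longrightarrow> ip (\<lambda>x. c * f x) g = c * ip f g"
    and ip_cnj: "f \<in> H \<Longrightarrow> g \<in> H \<Longrightarrow> ip g f = cnj (ip f g)"
    and ip_pos: "f \<in> H \<Longrightarrow> f \<noteq> (\<lambda>x. 0) \<Longrightarrow> 0 < Re (ip f f)"
    and complete:
      "(\<And>n. F n \<in> H) \<Longrightarrow>
       (\<forall>\<epsilon>>0. \<exists>N. \<forall>m\<ge>N. \<forall>n\<ge>N. ip_norm ip (\<lambda>x. F m x - F n x) < \<epsilon>) \<Longrightarrow>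
       \<exists>f\<in>H. (\<lambda>n :: nat. ip_norm ip (\<lambda>x. F n x - f x)) \<longlonglongrightarrow> 0"

definition kernel_fun :: "'a set \<Rightarrow> ('a \<Rightarrow> 'a \<Rightarrow> complex) \<Rightarrow> 'a \<Rightarrow> 'a \<Rightarrow> complex" where
  "kernel_fun \<Omega> K y = (\<lambda>x. if x \<in> \<Omega> then K x y else 0)"

locale rkhs = hilbert_function_space \<Omega> H ip
  for \<Omega> :: "'a set"
    and K :: "'a \<Rightarrow> 'a \<Rightarrow> complex"
    and H :: "('a \<Rightarrow> complex) set"
    and ip :: "('a \<Rightarrow> complex) \<Rightarrow> ('a \<Rightarrow> complex) \<Rightarrow> complex" +
  assumes kernel_mem: "y \<in> \<Omega> \<Longrightarrow> kernel_fun \<Omega> K y \<in> H"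
    and reproducing: "f \<in> H \<Longrightarrow> y \<in> \<Omega> \<Longrightarrow> ip f (kernel_fun \<Omega> K y) = f y"

text \<open>
  \<open>H \<otimes> \<complex>\<^sup>n\<close> is identified with the space of \<open>n\<close>-tuples \<open>(F 0, \<dots>, F (n - 1))\<close> of elements of \<open>H\<close>
  with squared norm \<open>\<parallel>F 0\<parallel>\<^sup>2 + \<dots> + \<parallel>F (n - 1)\<parallel>\<^sup>2\<close>; entries with index \<open>\<ge> n\<close> are ignored.
\<close>

definition tuple_norm ::
  "(('a \<Rightarrow> complex) \<Rightarrow> ('a \<Rightarrow> complex) \<Rightarrow> complex) \<Rightarrow> nat \<Rightarrow> (nat \<Rightarrow> 'a \<Rightarrow> complex) \<Rightarrow> real" where
  "tuple_norm ip n F = sqrt (\<Sum>j<n. (ip_norm ip (F j))\<^sup>2)"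

definition mult_op ::
  "nat \<Rightarrow> ('a \<Rightarrow> complex mat) \<Rightarrow> (nat \<Rightarrow> 'a \<Rightarrow> complex) \<Rightarrow> nat \<Rightarrow> 'a \<Rightarrow> complex" where
  "mult_op n \<Phi> F = (\<lambda>i x. \<Sum>j<n. \<Phi> x $$ (i, j) * F j x)"

text \<open>\<open>\<Phi>\<close> multiplies \<open>H \<otimes> \<complex>\<^sup>n\<close> into \<open>H \<otimes> \<complex>\<^sup>m\<close>, and \<open>\<parallel>M\<^sub>\<Phi>\<parallel> \<le> 1\<close>.\<close>

definition contractive_multiplier ::
  "'a set \<Rightarrow> ('a \<Rightarrow> complex) set \<Rightarrow> (('a \<Rightarrow> complex) \<Rightarrow> ('a \<Rightarrow> complex) \<Rightarrow> complex) \<Rightarrow>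
   nat \<Rightarrow> nat \<Rightarrow> ('a \<Rightarrow> complex mat) \<Rightarrow> bool" where
  "contractive_multiplier \<Omega> H ip m n \<Phi> \<longleftrightarrow>
     (\<forall>x\<in>\<Omega>. \<Phi> x \<in> carrier_mat m n) \<and>
     (\<forall>F. (\<forall>j<n. F j \<in> H) \<longrightarrow>
        (\<forall>i<m. mult_op n \<Phi> F i \<in> H) \<and> tuple_norm ip m (mult_op n \<Phi> F) \<le> tuple_norm ip n F)"

text \<open>The \<open>km \<times> km\<close> matrix with \<open>m \<times> m\<close> blocks \<open>(I - W\<^sub>i W\<^sub>j\<^sup>*) K(x\<^sub>i, x\<^sub>j)\<close>.\<close>

definition pick_mat ::
  "('a \<Rightarrow> 'a \<Rightarrow> complex) \<Rightarrow> nat \<Rightarrow> nat \<Rightarrow> (nat \<Rightarrow> 'a) \<Rightarrow> (nat \<Rightarrow> complex mat) \<Rightarrow> complex mat" where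
  "pick_mat K m k x W = Matrix.mat (k * m) (k * m) (\<lambda>(p, q).
     (K (x (p div m)) (x (q div m)) \<cdot>\<^sub>m (1\<^sub>m m - W (p div m) * mat_adjoint (W (q div m))))
       $$ (p mod m, q mod m))"

definition cnp_space ::
  "'a set \<Rightarrow> ('a \<Rightarrow> 'a \<Rightarrow> complex) \<Rightarrow> ('a \<Rightarrow> complex) set \<Rightarrow>
   (('a \<Rightarrow> complex) \<Rightarrow> ('a \<Rightarrow> complex) \<Rightarrow> complex) \<Rightarrow> bool" where
  "cnp_space \<Omega> K H ip \<longleftrightarrow>
     (\<forall>m n k (x :: nat \<Rightarrow> 'a) (W :: nat \<Rightarrow> complex mat).
        1 \<le> m \<and> 1 \<le> n \<and> inj_on x {..<k} \<and> x ` {..<k} \<subseteq> \<Omega> \<and> (\<forall>i<k. W i \<in> carrier_mat m n) \<and>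
        psd_mat (pick_mat K m k x W) \<longrightarrow>
        (\<exists>\<Phi>. contractive_multiplier \<Omega> H ip m n \<Phi> \<and> (\<forall>i<k. \<Phi> (x i) = W i)))"

text \<open>
  By the Moore-Aronszajn theorem, a positive semi-definite \<open>K\<close> has exactly one reproducing kernel
  Hilbert space (\<open>H\<close> and the restriction of \<open>ip\<close> to it), so the existential quantifier selects
  \<open>\<H>(K)\<close>.
\<close>

definition cnp_kernel :: "'a set \<Rightarrow> ('a \<Rightarrow> 'a \<Rightarrow> complex) \<Rightarrow> bool" where
  "cnp_kernel \<Omega> K \<longleftrightarrow> psd_kernel \<Omega> K \<and> (\<exists>H ip. rkhs \<Omega> K H ip \<and> cnp_space \<Omega> K H ip)"

definition bidisc :: "(complex \<times> complex) set" where
  "bidisc = ball 0 1 \<times> ball 0 1"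

text \<open>Holomorphy in two variables: the real Frechet derivative exists and is complex linear.\<close>

definition holomorphic2_on :: "(complex \<times> complex \<Rightarrow> complex) \<Rightarrow> (complex \<times> complex) set \<Rightarrow> bool" where
  "holomorphic2_on f U \<longleftrightarrow>
     (\<forall>z\<in>U. \<exists>a b. (f has_derivative (\<lambda>h. a * fst h + b * snd h)) (at z within U))"

definition H_inf_1_bidisc :: "(complex \<times> complex \<Rightarrow> complex) set" where
  "H_inf_1_bidisc = {\<phi>. holomorphic2_on \<phi> bidisc \<and> (\<forall>z\<in>bidisc. cmod (\<phi> z) \<le> 1)}"

definition szego2 :: "complex \<times> complex \<Rightarrow> complex \<times> complex \<Rightarrow> complex" where
  "szego2 z w = 1 / ((1 - fst z * cnj (fst w)) * (1 - snd z * cnj (snd w)))"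

definition dbr_kernel ::
  "(complex \<times> complex \<Rightarrow> complex) \<Rightarrow> complex \<times> complex \<Rightarrow> complex \<times> complex \<Rightarrow> complex" where
  "dbr_kernel \<phi> z w = (1 - \<phi> z * cnj (\<phi> w)) * szego2 z w"

definition disc_aut :: "complex \<Rightarrow> complex \<Rightarrow> complex" where
  "disc_aut \<mu> z = (z - \<mu>) / (1 - cnj \<mu> * z)"

end

theory Submission
  imports Defs "HOL-Complex_Analysis.Complex_Analysis"
begin

text \<open>
  If \<open>K = S\<^sub>2\<^sup>\<phi>\<close> is a CNP kernel, the McCullough--Quiggin condition with base point \<open>0\<close> says that
  \<open>1 - (1 - z\<^sub>1 w\<^sub>1\<^sup>*) (1 - z\<^sub>2 w\<^sub>2\<^sup>*) / (1 - \<psi>(z) \<psi>(w)\<^sup>*)\<close> is positive semi-definite, where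
  \<open>\<psi> = b\<^sub>\<mu> \<circ> \<phi>\<close> with \<open>\<mu> = \<phi>(0)\<close>. Nonnegativity of its Taylor coefficient at \<open>z\<^sub>1 z\<^sub>2 w\<^sub>1\<^sup>* w\<^sub>2\<^sup>*\<close> forces
  \<open>1 \<le> \<bar>a\<bar>\<^sup>2 + \<bar>b\<bar>\<^sup>2\<close> for the partial derivatives \<open>a, b\<close> of \<open>\<psi>\<close> at \<open>0\<close>, while the Schwarz lemma on
  complex lines gives \<open>\<bar>a\<bar> + \<bar>b\<bar> \<le> 1\<close>. So one of them is \<open>0\<close>, the other one is unimodular, and the
  equality case of the Schwarz lemma makes \<open>\<psi>\<close> a rotation of a coordinate function.

  Conversely, \<open>\<phi>(z) = \<lambda> b\<^sub>\<mu>(z\<^sub>1)\<close> gives \<open>K(z, w) = G(z) G(w)\<^sup>* / (1 - z\<^sub>2 w\<^sub>2\<^sup>*)\<close>, the kernel of a rescaled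
  Hardy space of the disc. Matrix-valued Pick interpolation there is solved by the transfer function of
  a contractive discrete-time linear system, whose multiplication operator is a contraction because
  the system does not create energy.
\<close>

section \<open>Positive semi-definite forms\<close>

text \<open>Since \<psi> vanishes at 0, first derivatives decide the Taylor coefficient. Expanding
  \<open>1 / (1 - \<psi> z * cnj (\<psi> w))\<close> geometrically, the coefficient receives -1 from
  the product of the two Szego denominators, the squared moduli of b and a from z1 \<psi> and z2
  \<psi>, and minus a square from each remaining term. The form is known to be positive only on
  finite sets of points, so the coefficient is replaced by a mixed second difference over four
  points that shrink to the origin. The necessity direction feeds only row-valued data (m = 1) into
  the CNP property, whereas sufficiency has to produce multipliers for all m x n data and solves the
  matrix problem directly. Finitely many data have a finite Gram factorisation, so a
  finite-dimensional system is enough, and the norm bound becomes a telescoping sum of energies over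
  time. The kernel drops to one variable because
  \<open>1 - disc_aut \<mu> z * cnj (disc_aut \<mu> w)\<close> contains the factor
  \<open>1 - z * cnj w\<close>, which cancels one of the two Szego denominators.\<close>

definition psd_on :: "'i set \<Rightarrow> ('i \<Rightarrow> 'i \<Rightarrow> complex) \<Rightarrow> bool" where
  "psd_on I P \<longleftrightarrow> (\<forall>c. 0 \<le> (\<Sum>i\<in>I. \<Sum>j\<in>I. cnj (c i) * P i j * c j))"

lemma psd_onD: "psd_on I P \<Longrightarrow> 0 \<le> (\<Sum>i\<in>I. \<Sum>j\<in>I. cnj (c i) * P i j * c j)"
  by (simp add: psd_on_def)

lemma psd_on_cong:
  assumes "\<And>i j. i \<in> I \<Longrightarrow> j \<in> I \<Longrightarrow> P i j = Q i j"
  shows "psd_on I P \<longleftrightarrow> psd_on I Q"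
  unfolding psd_on_def using assms by (simp cong: sum.cong)

lemma psd_on_mono:
  assumes "psd_on I P" "J \<subseteq> I" "finite I"
  shows "psd_on J P"
  unfolding psd_on_def
proof
  fix c :: "'a \<Rightarrow> complex"
  define d where "d i = (if i \<in> J then c i else 0)" for i
  have inner: "(\<Sum>j\<in>I. cnj (d i) * P i j * d j) = (\<Sum>j\<in>J. cnj (d i) * P i j * c j)" for i
    by (rule sum.mono_neutral_cong_right) (use assms in \<open>auto simp: d_def\<close>)
  have "(\<Sum>i\<in>I. \<Sum>j\<in>I. cnj (d i) * P i j * d j) = (\<Sum>i\<in>J. \<Sum>j\<in>J. cnj (c i) * P i j * c j)"
    unfolding inner
    by (rule sum.mono_neutral_cong_right) (use assms in \<open>auto simp: d_def\<close>)
  with psd_onD[OF assms(1), of d] show "0 \<le> (\<Sum>i\<in>J. \<Sum>j\<in>J. cnj (c i) * P i j * c j)"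
    by simp
qed

lemma psd_on_reindex:
  assumes "inj_on h I"
  shows "psd_on (h ` I) P \<longleftrightarrow> psd_on I (\<lambda>i j. P (h i) (h j))"
proof -
  have eq: "(\<Sum>i\<in>h ` I. \<Sum>j\<in>h ` I. cnj (c i) * P i j * c j)
      = (\<Sum>i\<in>I. \<Sum>j\<in>I. cnj (c (h i)) * P (h i) (h j) * c (h j))" for c
    by (simp add: sum.reindex[OF assms] o_def)
  have "\<exists>d. \<forall>i\<in>I. d (h i) = c i" for c :: "'a \<Rightarrow> complex"
    by (rule exI[of _ "\<lambda>x. c (inv_into I h x)"]) (simp add: assms)
  then have "psd_on I (\<lambda>i j. P (h i) (h j))" if "psd_on (h ` I) P"
    unfolding psd_on_def
  proof (intro allI)
    fix c :: "'a \<Rightarrow> complex"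
    obtain d where d: "\<forall>i\<in>I. d (h i) = c i"
      using \<open>\<And>c. \<exists>d. \<forall>i\<in>I. d (h i) = c i\<close> by blast
    show "0 \<le> (\<Sum>i\<in>I. \<Sum>j\<in>I. cnj (c i) * P (h i) (h j) * c j)"
      using psd_onD[OF that, of d] d by (simp add: eq cong: sum.cong)
  qed
  then show ?thesis
    by (auto simp: psd_on_def eq)
qed

lemma psd_on_add:
  assumes "psd_on I P" "psd_on I Q"
  shows "psd_on I (\<lambda>i j. P i j + Q i j)"
  using assms unfolding psd_on_def
  by (simp add: algebra_simps sum.distrib)

lemma sum_rank_one:
  fixes c f :: "'i \<Rightarrow> complex"
  shows "(\<Sum>i\<in>I. \<Sum>j\<in>I. cnj (c i) * (f i * cnj (f j)) * c j)
    = complex_of_real ((cmod (\<Sum>i\<in>I. cnj (c i) * f i))\<^sup>2)"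
  unfolding complex_norm_square cnj_sum sum_product
  by (intro sum.cong refl) simp

lemma psd_on_rank_one: "psd_on I (\<lambda>i j. f i * cnj (f j))"
  unfolding psd_on_def by (simp add: sum_rank_one less_eq_complex_def)

lemma psd_on_gram:
  assumes "\<And>i j. i \<in> I \<Longrightarrow> j \<in> I \<Longrightarrow> P i j = (\<Sum>l\<in>L. A i l * cnj (A j l))"
  shows "psd_on I P"
proof -
  have "psd_on I (\<lambda>i j. \<Sum>l\<in>L. A i l * cnj (A j l))"
  proof (induction L rule: infinite_finite_induct)
    case (insert l L)
    then show ?case
      using psd_on_add[OF psd_on_rank_one[where f = "\<lambda>i. A i l"] insert.IH] by simp
  qed (simp_all add: psd_on_def)
  then show ?thesis
    using psd_on_cong[of I P "\<lambda>i j. \<Sum>l\<in>L. A i l * cnj (A j l)"] assms by simp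
qed

lemma psd_on_pair:
  assumes "psd_on I P" "finite I" "i \<in> I" "j \<in> I" "i \<noteq> j"
  shows "0 \<le> cnj a * P i i * a + cnj a * P i j * b + cnj b * P j i * a + cnj b * P j j * b"
proof -
  have "psd_on {i, j} P"
    using assms by (intro psd_on_mono[OF assms(1)]) auto
  from psd_onD[OF this, of "\<lambda>x. if x = i then a else b"] show ?thesis
    using assms(5) by (simp add: add_ac)
qed

lemma psd_on_diag:
  assumes "psd_on I P" "finite I" "i \<in> I"
  shows "0 \<le> P i i"
proof -
  have "psd_on {i} P"
    using assms by (intro psd_on_mono[OF assms(1)]) auto
  from psd_onD[OF this, of "\<lambda>x. 1"] show ?thesis by simp
qed

text \<open>The order on the complex numbers makes a nonnegative form real; reality at the vectors
  (1, 1) and (1, \<open>\<i>\<close>) gives the imaginary and the real part of the claim.\<close>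

lemma psd_on_hermitian:
  assumes "psd_on I P" "finite I" "i \<in> I" "j \<in> I"
  shows "P j i = cnj (P i j)"
proof (cases "i = j")
  case True
  then show ?thesis
    using psd_on_diag[OF assms(1-3)] by (simp add: less_eq_complex_def complex_eq_iff)
next
  case False
  have d: "Im (P i i) = 0" "Im (P j j) = 0"
    using psd_on_diag[OF assms(1-3)] psd_on_diag[OF assms(1,2,4)] by (simp_all add: less_eq_complex_def)
  have "Im (P i j) + Im (P j i) = 0"
    using psd_on_pair[OF assms False, of 1 1] d by (simp add: less_eq_complex_def)
  moreover have "Re (P i j) - Re (P j i) = 0"
    using psd_on_pair[OF assms False, of 1 \<i>] d by (simp add: less_eq_complex_def)
  ultimately show ?thesis
    by (simp add: complex_eq_iff)
qed

lemma psd_on_zero_diag: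
  assumes "psd_on I P" "finite I" "i \<in> I" "j \<in> I" "P i i = 0"
  shows "P i j = 0"
proof (rule ccontr)
  assume nz: "P i j \<noteq> 0"
  then have neq: "i \<noteq> j"
    using assms(5) by auto
  define r where "r = Re (P j j)"
  have jj: "P j j = of_real r" "0 \<le> r"
    using psd_on_diag[OF assms(1,2,4)] by (simp_all add: less_eq_complex_def complex_eq_iff r_def)
  \<comment> \<open>At this vector each of the two off-diagonal terms equals -(r + 1) and the
    diagonal adds only r, so the form would be negative.\<close>
  have "0 \<le> - complex_of_real (r + 2)"
    using psd_on_pair[OF assms(1-4) neq, of "- of_real (r + 1) / cnj (P i j)" 1] nz
    by (simp add: psd_on_hermitian[OF assms(1-4)] assms(5) jj)
  with jj(2) show False
    by (simp add: less_eq_complex_def)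
qed

text \<open>For \<open>P a a = 0\<close> the subtracted term is \<open>0\<close> by the convention \<open>x / 0 = 0\<close>,
  which is consistent because then \<open>P i a = 0\<close>.\<close>

lemma psd_on_schur_complement:
  assumes psd: "psd_on (insert a I) P" and fin: "finite I" and a: "a \<notin> I"
  shows "psd_on I (\<lambda>i j. P i j - P i a * P a j / P a a)"
proof (cases "P a a = 0")
  case True
  then show ?thesis
    using psd_on_mono[OF psd, of I] fin by auto
next
  case False
  show ?thesis
    unfolding psd_on_def
  proof
    fix c :: "'a \<Rightarrow> complex"
    define s where "s = (\<Sum>j\<in>I. P a j * c j)"
    \<comment> \<open>For given values on \<open>I\<close>, this entry at \<open>a\<close> minimises
      the form; completing the square leaves the Schur complement.\<close>
    define d where "d = c(a := - s / P a a)"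
    have herm: "cnj (P a i) = P i a" if "i \<in> insert a I" for i
      using psd_on_hermitian[OF psd, of a i] that fin by simp
    have s': "(\<Sum>i\<in>I. cnj (c i) * P i a) = cnj s"
      unfolding s_def cnj_sum by (intro sum.cong refl) (simp add: herm mult.commute)
    have da: "d a = - s / P a a"
      by (simp add: d_def)
    have dI: "d i = c i" if "i \<in> I" for i
      using a that by (auto simp: d_def)
    have row: "(\<Sum>j\<in>I. cnj (d a) * P a j * d j) = cnj (d a) * s"
      unfolding s_def sum_distrib_left by (intro sum.cong refl) (simp add: dI)
    have "(\<Sum>i\<in>I. \<Sum>j\<in>insert a I. cnj (d i) * P i j * d j)
      = (\<Sum>i\<in>I. cnj (c i) * P i a * d a) + (\<Sum>i\<in>I. \<Sum>j\<in>I. cnj (c i) * P i j * c j)"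
      using a fin by (simp add: dI sum.distrib cong: sum.cong)
    also have "(\<Sum>i\<in>I. cnj (c i) * P i a * d a) = cnj s * d a"
      unfolding s'[symmetric] sum_distrib_right ..
    finally have "(\<Sum>i\<in>insert a I. \<Sum>j\<in>insert a I. cnj (d i) * P i j * d j)
      = cnj (d a) * P a a * d a + cnj (d a) * s + (cnj s * d a
        + (\<Sum>i\<in>I. \<Sum>j\<in>I. cnj (c i) * P i j * c j))"
      using a fin row by simp
    also have "\<dots> = (\<Sum>i\<in>I. \<Sum>j\<in>I. cnj (c i) * P i j * c j) - cnj s * s / P a a"
      using False herm[of a] by (simp add: da field_simps)
    also have "cnj s * s / P a a = (\<Sum>i\<in>I. \<Sum>j\<in>I. cnj (c i) * (P i a * P a j / P a a) * c j)"
      unfolding s'[symmetric] unfolding s_def sum_product sum_divide_distrib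
      by (intro sum.cong refl) simp
    finally have "(\<Sum>i\<in>insert a I. \<Sum>j\<in>insert a I. cnj (d i) * P i j * d j) =
      (\<Sum>i\<in>I. \<Sum>j\<in>I. cnj (c i) * (P i j - P i a * P a j / P a a) * c j)"
      by (simp add: sum_subtractf right_diff_distrib left_diff_distrib)
    with psd_onD[OF psd, of d] show "0 \<le> (\<Sum>i\<in>I. \<Sum>j\<in>I. cnj (c i) * (P i j - P i a * P a j / P a a) * c j)"
      by simp
  qed
qed

text \<open>Cholesky factorisation: split off row and column \<open>a\<close> and factor the Schur
  complement. The columns are labelled by \<open>I\<close> itself, which later fixes the dimension
  of the state space.\<close>

lemma psd_on_gram_exists:
  assumes "finite I" "psd_on I P"
  shows "\<exists>A. \<forall>i\<in>I. \<forall>j\<in>I. P i j = (\<Sum>l\<in>I. A i l * cnj (A j l))"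
  using assms
proof (induction I arbitrary: P rule: finite_induct)
  case (insert a I)
  note herm = psd_on_hermitian[OF insert.prems]
  obtain A where A: "\<And>i j. i \<in> I \<Longrightarrow> j \<in> I \<Longrightarrow>
      P i j - P i a * P a j / P a a = (\<Sum>l\<in>I. A i l * cnj (A j l))"
    using insert.IH[OF psd_on_schur_complement[OF insert.prems insert.hyps]] by blast
  define r where "r = sqrt (Re (P a a))"
  have r: "P a a = of_real r * of_real r"
    using psd_on_diag[OF insert.prems, of a] insert.hyps(1)
    by (simp add: r_def less_eq_complex_def complex_eq_iff)
  \<comment> \<open>Column \<open>a\<close> carries the eliminated entry. For r = 0 its quotient is
    0 by default, and row and column \<open>a\<close> of \<open>P\<close> do vanish then.\<close>
  define B where "B i l = (if l = a then (if i = a then of_real r else P i a / of_real r)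
      else if i = a then 0 else A i l)" for i l
  have "P i j = (\<Sum>l\<in>insert a I. B i l * cnj (B j l))" if "i \<in> insert a I" "j \<in> insert a I" for i j
  proof -
    have split: "(\<Sum>l\<in>insert a I. B i l * cnj (B j l)) = B i a * cnj (B j a) + (\<Sum>l\<in>I. B i l * cnj (B j l))"
      using insert.hyps by simp
    have zero: "P i a = 0" "P a j = 0" if "r = 0"
    proof -
      show "P a j = 0"
        using psd_on_zero_diag[OF insert.prems, of a j] that \<open>j \<in> insert a I\<close> insert.hyps(1) r by simp
      have "P a i = 0"
        using psd_on_zero_diag[OF insert.prems, of a i] that \<open>i \<in> insert a I\<close> insert.hyps(1) r by simp
      then show "P i a = 0"
        using herm[of a i] \<open>i \<in> insert a I\<close> insert.hyps(1) by simp
    qed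
    show ?thesis
    proof (cases "i = a \<or> j = a")
      case True
      have "(\<Sum>l\<in>I. B i l * cnj (B j l)) = 0"
        by (rule sum.neutral) (use True insert.hyps(2) in \<open>auto simp: B_def\<close>)
      then show ?thesis
        using True split zero herm[of j a] that insert.hyps(1) r
        by (cases "r = 0") (auto simp: B_def)
    next
      case False
      then have "(\<Sum>l\<in>I. B i l * cnj (B j l)) = (\<Sum>l\<in>I. A i l * cnj (A j l))"
        by (intro sum.cong) (use insert.hyps(2) in \<open>auto simp: B_def\<close>)
      also have "\<dots> = P i j - P i a * P a j / P a a"
        using A[of i j] False that by auto
      finally show ?thesis
        using False split herm[of j a] that insert.hyps(1) r by (simp add: B_def)
    qed
  qed
  then show ?case by blast
qed simp

lemma psd_mat_iff_psd_on:
  "psd_mat (Matrix.mat N N (\<lambda>(i, j). P i j)) \<longleftrightarrow> psd_on {..<N} P"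
proof -
  have eq: "(Matrix.mat N N (\<lambda>(i, j). P i j) *\<^sub>v v) \<bullet>c v
      = (\<Sum>i<N. \<Sum>j<N. cnj (vec_index v i) * P i j * vec_index v j)" if "v \<in> carrier_vec N" for v
    using that
    by (simp add: scalar_prod_def sum_distrib_left sum_distrib_right atLeast0LessThan mult_ac)
  have "psd_on {..<N} P" if *: "\<And>v. v \<in> carrier_vec N \<Longrightarrow> 0 \<le> (\<Sum>i<N. \<Sum>j<N. cnj (vec_index v i) * P i j * vec_index v j)"
    unfolding psd_on_def
  proof
    fix c :: "nat \<Rightarrow> complex"
    show "0 \<le> (\<Sum>i<N. \<Sum>j<N. cnj (c i) * P i j * c j)"
      using *[of "Matrix.vec N c"] by simp
  qed
  then show ?thesis
    unfolding psd_mat_def by (auto simp: eq psd_onD)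
qed

section \<open>Reproducing kernel Hilbert spaces\<close>

text \<open>The additional zero column keeps n positive even for empty \<open>I\<close>, as the
  interpolation data in \<open>cnp_space\<close> require.\<close>

lemma psd_on_gram_exists_nat:
  assumes "finite I" "psd_on I P"
  shows "\<exists>n A. 1 \<le> n \<and> (\<forall>i\<in>I. \<forall>j\<in>I. P i j = (\<Sum>l<n. A i l * cnj (A j (l::nat))))"
proof -
  obtain A where A: "\<And>i j. i \<in> I \<Longrightarrow> j \<in> I \<Longrightarrow> P i j = (\<Sum>l\<in>I. A i l * cnj (A j l))"
    using psd_on_gram_exists[OF assms] by blast
  obtain e where e: "bij_betw e {..<card I} I"
    using assms(1) ex_bij_betw_nat_finite[of I] by (auto simp: atLeast0LessThan)
  define B where "B i l = (if l < card I then A i (e l) else 0)" for i l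
  have "P i j = (\<Sum>l<Suc (card I). B i l * cnj (B j l))" if "i \<in> I" "j \<in> I" for i j
    using A[OF that] sum.reindex_bij_betw[OF e, of "\<lambda>l. A i l * cnj (A j l)"] by (simp add: B_def)
  then show ?thesis
    by (intro exI[of _ "Suc (card I)"] exI[of _ B]) auto
qed

lemma pick_mat_eq:
  assumes "\<And>i. i < k \<Longrightarrow> W i \<in> carrier_mat m n"
  shows "pick_mat K m k x W = Matrix.mat (k * m) (k * m) (\<lambda>(p, q). K (x (p div m)) (x (q div m)) *
    ((if p mod m = q mod m then 1 else 0)
      - (\<Sum>l<n. W (p div m) $$ (p mod m, l) * cnj (W (q div m) $$ (q mod m, l)))))"
  unfolding pick_mat_def
proof (rule cong_mat)
  fix p q assume pq: "p < k * m" "q < k * m"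
  then have m: "p mod m < m" "q mod m < m"
    by (metis less_nat_zero_code mult_0_right mod_less_divisor neq0_conv)+
  have W: "W (p div m) \<in> carrier_mat m n" "W (q div m) \<in> carrier_mat m n"
    using pq by (auto intro!: assms simp: less_mult_imp_div_less)
  have "(W (p div m) * mat_adjoint (W (q div m))) $$ (p mod m, q mod m)
      = (\<Sum>l<n. W (p div m) $$ (p mod m, l) * cnj (W (q div m) $$ (q mod m, l)))"
    using W m by (simp add: mat_adjoint_def mat_of_rows_def scalar_prod_def atLeast0LessThan)
  then show "(case (p, q) of (p, q) \<Rightarrow> (K (x (p div m)) (x (q div m)) \<cdot>\<^sub>m
      (1\<^sub>m m - W (p div m) * mat_adjoint (W (q div m)))) $$ (p mod m, q mod m)) =
    (case (p, q) of (p, q) \<Rightarrow> K (x (p div m)) (x (q div m)) * ((if p mod m = q mod m then 1 else 0)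
      - (\<Sum>l<n. W (p div m) $$ (p mod m, l) * cnj (W (q div m) $$ (q mod m, l)))))"
    using W m by (simp add: mat_adjoint_def)
qed auto

section \<open>Norm and Cauchy-Schwarz inequality in a Hilbert space of functions\<close>

context hilbert_function_space
begin

lemma sum_scale_mem:
  assumes "\<And>i. i \<in> I \<Longrightarrow> f i \<in> H"
  shows "(\<lambda>x. \<Sum>i\<in>I. c i * f i x) \<in> H"
  using assms
proof (induction I rule: infinite_finite_induct)
  case (insert i I)
  then show ?case
    using add_mem[OF scale_mem, of "f i" "\<lambda>x. \<Sum>i\<in>I. c i * f i x" "c i"] by simp
qed (simp_all add: zero_mem)

lemma ip_zero_left: "g \<in> H \<Longrightarrow> ip (\<lambda>x. 0) g = 0"
  using ip_scale[OF zero_mem, of g 0] by simp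

lemma ip_sum_left:
  assumes "\<And>i. i \<in> I \<Longrightarrow> f i \<in> H" "g \<in> H"
  shows "ip (\<lambda>x. \<Sum>i\<in>I. c i * f i x) g = (\<Sum>i\<in>I. c i * ip (f i) g)"
  using assms
proof (induction I rule: infinite_finite_induct)
  case (insert i I)
  then show ?case
    using ip_add[OF scale_mem sum_scale_mem, of "f i" I f g "c i" c] by (simp add: ip_scale)
qed (simp_all add: ip_zero_left)

lemma ip_sum_right:
  assumes "\<And>i. i \<in> I \<Longrightarrow> f i \<in> H" "g \<in> H"
  shows "ip g (\<lambda>x. \<Sum>i\<in>I. c i * f i x) = (\<Sum>i\<in>I. cnj (c i) * ip g (f i))"
proof -
  have "ip g (\<lambda>x. \<Sum>i\<in>I. c i * f i x) = cnj (\<Sum>i\<in>I. c i * ip (f i) g)"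
    using ip_cnj[OF sum_scale_mem assms(2), of I f c] ip_sum_left[of I f g c] assms by simp
  also have "\<dots> = (\<Sum>i\<in>I. cnj (c i) * ip g (f i))"
    unfolding cnj_sum using assms by (intro sum.cong refl) (simp add: ip_cnj[of _ g])
  finally show ?thesis .
qed

lemma ip_self: "f \<in> H \<Longrightarrow> ip f f = of_real ((ip_norm ip f)\<^sup>2)"
  using ip_cnj[of f f] ip_pos[of f] ip_zero_left[OF zero_mem]
  by (cases "f = (\<lambda>x. 0)") (auto simp: ip_norm_def complex_eq_iff)

lemma ip_norm_nonneg: "f \<in> H \<Longrightarrow> 0 \<le> ip_norm ip f"
  using ip_pos[of f] ip_zero_left[OF zero_mem]
  by (cases "f = (\<lambda>x. 0)") (auto simp: ip_norm_def)

text \<open>The Gram matrix of f and g, indexed by the booleans, is positive semi-definite; its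
  Schur complement at f is the inequality divided by the squared norm of f.\<close>

lemma Cauchy_Schwarz:
  assumes "f \<in> H" "g \<in> H"
  shows "cmod (ip f g) \<le> ip_norm ip f * ip_norm ip g"
proof -
  define h where "h = (\<lambda>b. if b then f else g)"
  have "psd_on UNIV (\<lambda>b b'. ip (h b') (h b))"
    unfolding psd_on_def
  proof
    fix c :: "bool \<Rightarrow> complex"
    have h: "h b \<in> H" for b using assms by (simp add: h_def)
    define s where "s = (\<lambda>x. \<Sum>b\<in>UNIV. c b * h b x)"
    have s: "s \<in> H" unfolding s_def by (rule sum_scale_mem) (rule h)
    have "(\<Sum>b\<in>UNIV. \<Sum>b'\<in>UNIV. cnj (c b) * ip (h b') (h b) * c b') = (\<Sum>b\<in>UNIV. cnj (c b) * ip s (h b))"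
      unfolding s_def using ip_sum_left[where f = h and I = UNIV and c = c] h
      by (simp add: sum_distrib_left mult_ac)
    also have "\<dots> = ip s s"
      using ip_sum_right[where f = h and I = UNIV and c = c and g = s] h s by (simp add: s_def)
    also have "0 \<le> \<dots>"
      using ip_self[OF s] by (simp add: less_eq_complex_def)
    finally show "0 \<le> (\<Sum>b\<in>UNIV. \<Sum>b'\<in>UNIV. cnj (c b) * ip (h b') (h b) * c b')" .
  qed
  then have psd: "psd_on (insert True {False}) (\<lambda>b b'. ip (h b') (h b))"
    by (simp add: UNIV_bool insert_commute)
  have "0 \<le> ip g g - ip f g * ip g f / ip f f"
    using psd_on_diag[OF psd_on_schur_complement[OF psd], of False] by (simp add: h_def mult.commute)
  also have "ip f g * ip g f = of_real ((cmod (ip f g))\<^sup>2)"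
    using ip_cnj[OF assms] by (simp only: complex_norm_square)
  finally have le: "(cmod (ip f g))\<^sup>2 / (ip_norm ip f)\<^sup>2 \<le> (ip_norm ip g)\<^sup>2"
    using assms by (simp add: ip_self less_eq_complex_def flip: of_real_divide)
  show ?thesis
  proof (cases "f = (\<lambda>x. 0)")
    case True
    then show ?thesis
      using ip_norm_nonneg assms by (simp add: ip_zero_left)
  next
    case False
    then have "0 < (ip_norm ip f)\<^sup>2"
      using ip_pos[OF assms(1)] ip_self[OF assms(1)] by simp
    then have "(cmod (ip f g))\<^sup>2 \<le> (ip_norm ip f * ip_norm ip g)\<^sup>2"
      using le by (simp add: field_simps power_mult_distrib)
    then show ?thesis
      using assms ip_norm_nonneg power2_le_imp_le by (simp add: mult_nonneg_nonneg)
  qed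
qed

end

context rkhs
begin

lemma kernel_fun_combination:
  fixes c :: "'a \<Rightarrow> complex"
  assumes "I \<subseteq> \<Omega>"
  shows "(\<lambda>z. \<Sum>y\<in>I. c y * kernel_fun \<Omega> K y z) \<in> H"
    and "x \<in> \<Omega> \<Longrightarrow> (\<Sum>y\<in>I. c y * kernel_fun \<Omega> K y x) = (\<Sum>y\<in>I. c y * K x y)"
    and "f \<in> H \<Longrightarrow> ip f (\<lambda>z. \<Sum>y\<in>I. c y * kernel_fun \<Omega> K y z) = (\<Sum>y\<in>I. cnj (c y) * f y)"
    and "ip (\<lambda>z. \<Sum>y\<in>I. c y * kernel_fun \<Omega> K y z) (\<lambda>z. \<Sum>y\<in>I. c y * kernel_fun \<Omega> K y z)
      = (\<Sum>x\<in>I. \<Sum>y\<in>I. cnj (c x) * K x y * c y)"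
proof -
  have k: "y \<in> I \<Longrightarrow> kernel_fun \<Omega> K y \<in> H" for y
    using kernel_mem assms by blast
  show mem: "(\<lambda>z. \<Sum>y\<in>I. c y * kernel_fun \<Omega> K y z) \<in> H"
    by (rule sum_scale_mem[OF k])
  show val: "(\<Sum>y\<in>I. c y * kernel_fun \<Omega> K y x) = (\<Sum>y\<in>I. c y * K x y)" if "x \<in> \<Omega>" for x
    using that by (simp add: kernel_fun_def)
  show ev: "ip f (\<lambda>z. \<Sum>y\<in>I. c y * kernel_fun \<Omega> K y z) = (\<Sum>y\<in>I. cnj (c y) * f y)" if "f \<in> H" for f
    using ip_sum_right[where f = "kernel_fun \<Omega> K" and c = c, OF k that] reproducing[OF that] assms
    by (simp add: subset_iff)
  show "ip (\<lambda>z. \<Sum>y\<in>I. c y * kernel_fun \<Omega> K y z) (\<lambda>z. \<Sum>y\<in>I. c y * kernel_fun \<Omega> K y z)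
      = (\<Sum>x\<in>I. \<Sum>y\<in>I. cnj (c x) * K x y * c y)"
    unfolding ev[OF mem] using assms val
    by (intro sum.cong refl) (auto simp: sum_distrib_left mult_ac subset_iff)
qed

lemma psd_on_kernel:
  assumes "I \<subseteq> \<Omega>"
  shows "psd_on I K"
  unfolding psd_on_def
  using ip_self[OF kernel_fun_combination(1)[OF assms]] kernel_fun_combination(4)[OF assms]
  by (auto simp: less_eq_complex_def simp flip: Re_sum Im_sum)

lemma psd_kernel: "psd_kernel \<Omega> K"
  unfolding psd_kernel_def psd_mat_iff_psd_on
  using psd_on_kernel psd_on_reindex by blast

text \<open>The adjoint of multiplication by \<open>\<Phi>\<close> maps the kernel function at \<open>y\<close> to its multiple by \<open>\<Phi> y\<^sup>*\<close>.\<close>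

lemma contractive_multiplier_psd_on:
  assumes mult: "contractive_multiplier \<Omega> H ip 1 n \<Phi>" and I: "I \<subseteq> \<Omega>"
  shows "psd_on I (\<lambda>x y. (1 - (\<Sum>l<n. \<Phi> x $$ (0, l) * cnj (\<Phi> y $$ (0, l)))) * K x y)"
  unfolding psd_on_def
proof
  fix c :: "'a \<Rightarrow> complex"
  define f where "f = (\<lambda>z. \<Sum>y\<in>I. c y * kernel_fun \<Omega> K y z)"
  define g where "g l = (\<lambda>z. \<Sum>y\<in>I. (c y * cnj (\<Phi> y $$ (0, l))) * kernel_fun \<Omega> K y z)" for l
  define h where "h = mult_op n \<Phi> g 0"
  define t where "t = tuple_norm ip n g"
  have fH: "f \<in> H" and gH: "g l \<in> H" for l
    unfolding f_def g_def by (rule kernel_fun_combination(1)[OF I])+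
  have hH: "h \<in> H" and h_le: "ip_norm ip h \<le> t"
  proof -
    from mult gH have *: "\<forall>i<1. mult_op n \<Phi> g i \<in> H" "tuple_norm ip 1 (mult_op n \<Phi> g) \<le> tuple_norm ip n g"
      unfolding contractive_multiplier_def by blast+
    then show "h \<in> H" by (simp add: h_def)
    then show "ip_norm ip h \<le> t"
      using *(2) ip_norm_nonneg by (simp add: tuple_norm_def h_def t_def)
  qed
  have t2: "t\<^sup>2 = (\<Sum>l<n. (ip_norm ip (g l))\<^sup>2)" and t0: "0 \<le> t"
    by (simp_all add: t_def tuple_norm_def sum_nonneg)
  have gg: "ip (g l) (g l) = (\<Sum>x\<in>I. \<Sum>y\<in>I. cnj (c x) * (\<Phi> x $$ (0, l) * cnj (\<Phi> y $$ (0, l)) * K x y) * c y)" for l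
    unfolding g_def using kernel_fun_combination(4)[OF I, of "\<lambda>y. c y * cnj (\<Phi> y $$ (0, l))"]
    by (simp add: mult_ac)
  \<comment> \<open>The tuple \<open>g\<close> is the image of \<open>f\<close> under the adjoint.
    Pairing \<open>h\<close>, the image of \<open>g\<close> under multiplication, with
    \<open>f\<close> returns the squared norm of \<open>g\<close>, so Cauchy-Schwarz bounds the
    adjoint without constructing it.\<close>
  have "ip h f = (\<Sum>x\<in>I. cnj (c x) * h x)"
    unfolding f_def by (rule kernel_fun_combination(3)[OF I hH])
  also have "\<dots> = (\<Sum>x\<in>I. \<Sum>l<n. cnj (c x) * \<Phi> x $$ (0, l) * g l x)"
    by (simp add: h_def mult_op_def sum_distrib_left mult.assoc)
  also have "\<dots> = (\<Sum>l<n. \<Sum>x\<in>I. cnj (c x) * \<Phi> x $$ (0, l) * g l x)"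
    by (rule sum.swap)
  also have "\<dots> = (\<Sum>l<n. ip (g l) (g l))"
  proof (intro sum.cong refl)
    fix l
    show "(\<Sum>x\<in>I. cnj (c x) * \<Phi> x $$ (0, l) * g l x) = ip (g l) (g l)"
      using kernel_fun_combination(3)[OF I gH[of l], of "\<lambda>y. c y * cnj (\<Phi> y $$ (0, l))"]
      by (simp flip: g_def)
  qed
  also have "\<dots> = of_real (t\<^sup>2)"
    by (simp only: ip_self[OF gH] t2 of_real_sum)
  finally have "t\<^sup>2 \<le> ip_norm ip h * ip_norm ip f"
    using Cauchy_Schwarz[OF hH fH] by (simp add: norm_power)
  also have "\<dots> \<le> t * ip_norm ip f"
    using h_le ip_norm_nonneg[OF fH] by (rule mult_right_mono)
  finally have "t \<le> ip_norm ip f"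
    using t0 ip_norm_nonneg[OF fH] by (cases "t = 0") (auto simp: power2_eq_square)
  then have le: "t\<^sup>2 \<le> (ip_norm ip f)\<^sup>2"
    using t0 by (rule power_mono)
  have "(\<Sum>x\<in>I. \<Sum>y\<in>I. cnj (c x) * ((1 - (\<Sum>l<n. \<Phi> x $$ (0, l) * cnj (\<Phi> y $$ (0, l)))) * K x y) * c y)
    = (\<Sum>x\<in>I. \<Sum>y\<in>I. cnj (c x) * K x y * c y)
      - (\<Sum>x\<in>I. \<Sum>y\<in>I. \<Sum>l<n. cnj (c x) * (\<Phi> x $$ (0, l) * cnj (\<Phi> y $$ (0, l)) * K x y) * c y)"
    by (simp add: left_diff_distrib right_diff_distrib sum_subtractf sum_distrib_left sum_distrib_right mult_ac)
  also have "(\<Sum>x\<in>I. \<Sum>y\<in>I. \<Sum>l<n. cnj (c x) * (\<Phi> x $$ (0, l) * cnj (\<Phi> y $$ (0, l)) * K x y) * c y)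
    = (\<Sum>l<n. ip (g l) (g l))"
    unfolding gg by (subst sum.swap[of _ "{..<n}"], subst sum.swap[of _ "{..<n}"]) (rule refl)
  also have "\<dots> = of_real (t\<^sup>2)"
    by (simp only: ip_self[OF gH] t2 of_real_sum)
  also have "(\<Sum>x\<in>I. \<Sum>y\<in>I. cnj (c x) * K x y * c y) = of_real ((ip_norm ip f)\<^sup>2)"
    using kernel_fun_combination(4)[OF I, of c] ip_self[OF fH] by (simp add: f_def)
  finally show "0 \<le> (\<Sum>x\<in>I. \<Sum>y\<in>I. cnj (c x) *
      ((1 - (\<Sum>l<n. \<Phi> x $$ (0, l) * cnj (\<Phi> y $$ (0, l)))) * K x y) * c y)"
    using le by (simp add: less_eq_complex_def flip: of_real_diff of_real_power)
qed

end

section \<open>The McCullough--Quiggin condition\<close>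

text \<open>The McCullough--Quiggin condition, one point at a time. If it holds on \<open>I\<close>, its Gram vectors \<open>A\<close>
  are admissible interpolation data \<open>W\<close> on \<open>I\<close> with \<open>W p = 0\<close>, whose Pick matrix has rank one.
  An interpolating multiplier then has a prescribed value at the next point \<open>q\<close> up to a positive
  defect at \<open>(q, q)\<close>, because Schur complements at \<open>p\<close> vanish on the diagonal of \<open>I\<close>.\<close>

lemma (in rkhs) cnp_space_psd_on:
  assumes cnp: "cnp_space \<Omega> K H ip"
    and nz: "\<And>x y. x \<in> \<Omega> \<Longrightarrow> y \<in> \<Omega> \<Longrightarrow> K x y \<noteq> 0"
    and p: "p \<in> \<Omega>"
    and "finite I" "I \<subseteq> \<Omega>" "p \<notin> I"
  shows "psd_on I (\<lambda>x y. 1 - K x p * K p y / (K x y * K p p))"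
  using assms(4-)
proof (induction I rule: finite_induct)
  case empty
  show ?case by (simp add: psd_on_def)
next
  case (insert q I)
  define F where "F x y = 1 - K x p * K p y / (K x y * K p p)" for x y
  have sub: "insert p (insert q I) \<subseteq> \<Omega>" and fin: "finite (insert p (insert q I))"
    using insert p by auto
  have herm: "K y x = cnj (K x y)" if "x \<in> \<Omega>" "y \<in> \<Omega>" for x y
    using psd_on_hermitian[OF psd_on_kernel[of "{x, y}"], of x y] that by simp
  have diag: "0 \<le> K x x" if "x \<in> \<Omega>" for x
    using psd_on_diag[OF psd_on_kernel[of "{x}"], of x] that by simp
  have "psd_on I F"
    using insert unfolding F_def by simp
  then obtain n A where n: "1 \<le> n" and A: "\<And>x y. x \<in> I \<Longrightarrow> y \<in> I \<Longrightarrow> F x y = (\<Sum>l<n. A x l * cnj (A y (l::nat)))"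
    using psd_on_gram_exists_nat[OF insert.hyps(1)] by blast
  define k where "k = card (insert p I)"
  obtain x where "bij_betw x {..<k} (insert p I)"
    using ex_bij_betw_nat_finite[of "insert p I"] insert.hyps(1) by (auto simp: atLeast0LessThan k_def)
  then have x: "inj_on x {..<k}" "x ` {..<k} = insert p I"
    by (simp_all add: bij_betw_def)
  define w where "w y l = (if y = p then 0 else A y l)" for y l
  define W where "W i = Matrix.mat 1 n (\<lambda>(s, l). w (x i) l)" for i
  have W: "W i \<in> carrier_mat 1 n" for i
    by (simp add: W_def)
  define V where "V y z = K y z * (1 - (\<Sum>l<n. w y l * cnj (w z l)))" for y z
  define r where "r = sqrt (Re (K p p))"
  have r: "K p p = of_real r * of_real r" "r \<noteq> 0"
    using diag[OF p] nz[OF p p] by (auto simp: r_def less_eq_complex_def complex_eq_iff)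
  \<comment> \<open>Away from p the Gram identity turns the bracket in \<open>V\<close> into K y p K
    p z / (K y z K p p), and K y z cancels. At p the vector w is 0 and both sides are kernel
    values.\<close>
  have V: "V y z = K y p / of_real r * cnj (K z p / of_real r)" if "y \<in> insert p I" "z \<in> insert p I" for y z
  proof -
    have \<Omega>: "y \<in> \<Omega>" "z \<in> \<Omega>"
      using that sub by auto
    have "V y z = K y p * K p z / K p p"
    proof (cases "y = p \<or> z = p")
      case True
      then show ?thesis
        using nz[OF p p] by (auto simp: V_def w_def)
    next
      case False
      then show ?thesis
        using that nz[OF \<Omega>] by (auto simp: V_def w_def F_def A[symmetric])
    qed
    then show ?thesis
      using herm[of z p] \<Omega> p r by simp
  qed
  have "psd_on (insert p I) V"
    using psd_on_rank_one[of "insert p I" "\<lambda>y. K y p / of_real r"] psd_on_cong[of "insert p I", OF V] by simp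
  then have "psd_on {..<k} (\<lambda>i j. V (x i) (x j))"
    using psd_on_reindex[OF x(1), of V] x(2) by simp
  moreover have "pick_mat K 1 k x W = Matrix.mat k k (\<lambda>(i, j). V (x i) (x j))"
    unfolding pick_mat_eq[OF W] by (rule cong_mat) (auto simp: V_def W_def)
  ultimately have psd: "psd_mat (pick_mat K 1 k x W)"
    by (simp add: psd_mat_iff_psd_on)
  have "inj_on x {..<k} \<and> x ` {..<k} \<subseteq> \<Omega>"
    using x sub by auto
  then obtain \<Phi> where \<Phi>: "contractive_multiplier \<Omega> H ip 1 n \<Phi>" "\<And>i. i < k \<Longrightarrow> \<Phi> (x i) = W i"
    using cnp[unfolded cnp_space_def, THEN spec, of 1, THEN spec, of n, THEN spec, of k, THEN spec, of x,
        THEN spec, of W] n W psd by auto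
  define G where "G y z = (\<Sum>l<n. \<Phi> y $$ (0, l) * cnj (\<Phi> z $$ (0, l)))" for y z
  define Y where "Y y z = (1 - G y z) * K y z" for y z
  define Z where "Z y z = Y y z - Y y p * Y p z / Y p p" for y z
  have \<Phi>w: "\<Phi> y $$ (0, l) = w y l" if "y \<in> insert p I" "l < n" for y l
  proof -
    have "y \<in> x ` {..<k}"
      using that(1) x(2) by simp
    then obtain i where "i < k" "x i = y"
      by auto
    then show ?thesis
      using \<Phi>(2)[of i] that(2) by (simp add: W_def)
  qed
  have Yp: "Y y p = K y p" "Y p y = K p y" for y
    using \<Phi>w[of p] by (simp_all add: Y_def G_def w_def)
  have psdZ: "psd_on (insert q I) Z"
    unfolding Z_def
  proof (rule psd_on_schur_complement)
    show "psd_on (insert p (insert q I)) Y"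
      using contractive_multiplier_psd_on[OF \<Phi>(1) sub] by (simp add: Y_def[abs_def] G_def)
  qed (use insert in auto)
  \<comment> \<open>As \<Phi> vanishes at p, the row and column of \<open>Y\<close> at p are those
    of \<open>K\<close>. Entrywise division by \<open>K\<close> does not preserve positivity in
    general; it is harmless here because \<open>Z\<close> turns out to be supported at (q,
    q).\<close>
  have ZF: "F y z = G y z + Z y z / K y z" if "y \<in> \<Omega>" "z \<in> \<Omega>" for y z
  proof -
    have "Z y z = (1 - G y z) * K y z - K y p * K p z / K p p"
      unfolding Z_def Yp by (simp add: Y_def)
    then show ?thesis
      using nz[OF that] by (simp add: F_def diff_divide_distrib mult.commute)
  qed
  have finq: "finite (insert q I)"
    using insert by simp
  have ZI: "Z y y = 0" if "y \<in> I" for y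
  proof -
    have "w y l = A y l" for l
      using that insert.prems by (cases "y = p") (simp_all add: w_def)
    then have "G y y = F y y"
      using \<Phi>w[of y] A[of y y] that by (simp add: G_def)
    then show ?thesis
      using ZF[of y y] nz[of y y] that sub by auto
  qed
  have Z0: "Z y z = 0" if "y \<in> insert q I" "z \<in> insert q I" "\<not> (y = q \<and> z = q)" for y z
  proof (cases "y \<in> I")
    case True
    then show ?thesis
      using psd_on_zero_diag[OF psdZ finq that(1,2)] ZI by blast
  next
    case False
    then have "z \<in> I" using that by auto
    then have "Z z y = 0"
      using psd_on_zero_diag[OF psdZ finq that(2,1)] ZI by blast
    then show ?thesis
      using psd_on_hermitian[OF psdZ finq that(2,1)] by simp
  qed
  define d where "d = Re (Z q q) / Re (K q q)"
  have q: "q \<in> \<Omega>" using sub by auto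
  have "Z q q = of_real (Re (Z q q))" "K q q = of_real (Re (K q q))" "0 \<le> Re (Z q q)" "0 \<le> Re (K q q)"
    using psd_on_diag[OF psdZ finq, of q] diag[OF q] by (auto simp: less_eq_complex_def complex_eq_iff)
  then have d: "Z q q / K q q = of_real d" and d0: "0 \<le> d"
    unfolding d_def by (metis of_real_divide, metis divide_nonneg_nonneg)
  have F: "F y z = G y z + (if y = q then of_real (sqrt d) else 0) * cnj (if z = q then of_real (sqrt d) else 0)"
    if "y \<in> insert q I" "z \<in> insert q I" for y z
  proof -
    have "F y z = G y z + Z y z / K y z"
      using that sub by (intro ZF) auto
    then show ?thesis
      using Z0[OF that] d d0 by (cases "y = q \<and> z = q") (auto simp flip: of_real_mult)
  qed
  have "psd_on (insert q I) G"
    by (rule psd_on_gram) (simp add: G_def)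
  from psd_on_add[OF this psd_on_rank_one[of _ "\<lambda>y. if y = q then of_real (sqrt d) else 0"]]
  have "psd_on (insert q I) F"
    using psd_on_cong[of "insert q I", OF F] by simp
  then show ?case
    unfolding F_def .
qed

section \<open>Self-maps of the bidisc\<close>

lemma open_bidisc: "open bidisc"
  unfolding bidisc_def by (intro open_Times open_ball)

lemma holomorphic2_on_bidisc_at:
  assumes "holomorphic2_on f bidisc" "z \<in> bidisc"
  shows "\<exists>a b. (f has_derivative (\<lambda>h. a * fst h + b * snd h)) (at z)"
  using assms at_within_open[OF assms(2) open_bidisc] unfolding holomorphic2_on_def by fastforce

lemma slice_has_field_derivative:
  fixes f :: "complex \<times> complex \<Rightarrow> complex"
  assumes "(f has_derivative (\<lambda>h. a * fst h + b * snd h)) (at (p + \<zeta> * u, q + \<zeta> * v))"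
  shows "((\<lambda>\<zeta>. f (p + \<zeta> * u, q + \<zeta> * v)) has_field_derivative (a * u + b * v)) (at \<zeta>)"
proof -
  have "((\<lambda>\<zeta>. (p + \<zeta> * u, q + \<zeta> * v)) has_derivative (\<lambda>h. (h * u, h * v))) (at \<zeta>)"
    by (auto intro!: derivative_eq_intros)
  from has_derivative_compose[OF this assms] show ?thesis
    unfolding has_field_derivative_def by (rule has_derivative_eq_rhs) (simp add: fun_eq_iff algebra_simps)
qed

lemma slice_holomorphic:
  assumes "holomorphic2_on f bidisc" "\<And>\<zeta>. \<zeta> \<in> S \<Longrightarrow> (p + \<zeta> * u, q + \<zeta> * v) \<in> bidisc"
  shows "(\<lambda>\<zeta>. f (p + \<zeta> * u, q + \<zeta> * v)) holomorphic_on S"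
  unfolding holomorphic_on_def
proof
  fix \<zeta> assume "\<zeta> \<in> S"
  from holomorphic2_on_bidisc_at[OF assms(1) assms(2)[OF this]] obtain a b where
    "(f has_derivative (\<lambda>h. a * fst h + b * snd h)) (at (p + \<zeta> * u, q + \<zeta> * v))"
    by blast
  then show "(\<lambda>\<zeta>. f (p + \<zeta> * u, q + \<zeta> * v)) field_differentiable at \<zeta> within S"
    using slice_has_field_derivative field_differentiable_def field_differentiable_at_within by blast
qed

text \<open>If the modulus 1 is attained at p, the maximum modulus principle applies on the complex
  line through p and any q, whose part inside the bidisc is convex and hence connected.\<close>

lemma nonconstant_H_inf_norm_less:
  assumes \<phi>: "\<phi> \<in> H_inf_1_bidisc" and nc: "\<not> \<phi> constant_on bidisc" and p: "p \<in> bidisc"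
  shows "cmod (\<phi> p) < 1"
proof (rule ccontr)
  assume "\<not> cmod (\<phi> p) < 1"
  have hol: "holomorphic2_on \<phi> bidisc" and le: "\<And>z. z \<in> bidisc \<Longrightarrow> cmod (\<phi> z) \<le> 1"
    using \<phi> by (auto simp: H_inf_1_bidisc_def)
  have "\<phi> q = \<phi> p" if q: "q \<in> bidisc" for q
  proof -
    define S where "S = {\<zeta>. fst p + \<zeta> * (fst q - fst p) \<in> ball 0 1 \<and> snd p + \<zeta> * (snd q - snd p) \<in> ball 0 1}"
    define g where "g \<zeta> = \<phi> (fst p + \<zeta> * (fst q - fst p), snd p + \<zeta> * (snd q - snd p))" for \<zeta>
    have S: "S = (\<lambda>\<zeta>. fst p + \<zeta> * (fst q - fst p)) -` ball 0 1 \<inter> (\<lambda>\<zeta>. snd p + \<zeta> * (snd q - snd p)) -` ball 0 1"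
      by (auto simp: S_def)
    have "open S"
      unfolding S by (intro open_Int open_vimage open_ball continuous_intros)
    moreover have "convex S"
    proof (rule convexI)
      fix x y and s t :: real
      assume xy: "x \<in> S" "y \<in> S" and st: "0 \<le> s" "0 \<le> t" "s + t = 1"
      have eq: "a + (s *\<^sub>R x + t *\<^sub>R y) * b = s *\<^sub>R (a + x * b) + t *\<^sub>R (a + y * b)" for a b :: complex
      proof -
        have "a = (s + t) *\<^sub>R a" using st by simp
        then show ?thesis by (simp add: algebra_simps)
      qed
      show "s *\<^sub>R x + t *\<^sub>R y \<in> S"
        using xy st convexD[OF convex_ball[of "0::complex" 1] _ _ st]
        by (simp only: S_def mem_Collect_eq eq)
    qed
    moreover have "g holomorphic_on S"
      unfolding g_def by (rule slice_holomorphic[OF hol]) (auto simp: S_def bidisc_def)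
    moreover have "0 \<in> S" "1 \<in> S"
      using p q by (auto simp: S_def bidisc_def)
    moreover have "cmod (g \<zeta>) \<le> cmod (g 0)" if "\<zeta> \<in> S" for \<zeta>
      using le[of "(fst p + \<zeta> * (fst q - fst p), snd p + \<zeta> * (snd q - snd p))"] that \<open>\<not> cmod (\<phi> p) < 1\<close>
      by (auto simp: g_def S_def bidisc_def)
    ultimately have "g constant_on S"
      using convex_connected by (intro maximum_modulus_principle[of g S S 0]) auto
    then have "g 1 = g 0"
      using \<open>0 \<in> S\<close> \<open>1 \<in> S\<close> by (auto simp: constant_on_def)
    then show ?thesis
      by (simp add: g_def)
  qed
  then show False
    using nc by (auto simp: constant_on_def)
qed

section \<open>The Schwarz lemma for maps from the bidisc to the disc\<close>

lemma disc_aut_eq_Moebius_function: "disc_aut \<mu> = Moebius_function 0 \<mu>"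
  by (simp add: disc_aut_def Moebius_function_def fun_eq_iff)

locale bidisc_schwarz =
  fixes \<psi> :: "complex \<times> complex \<Rightarrow> complex" and a b :: complex
  assumes hol: "holomorphic2_on \<psi> bidisc"
    and less_1: "z \<in> bidisc \<Longrightarrow> cmod (\<psi> z) < 1"
    and zero: "\<psi> (0, 0) = 0"
    and derivative: "(\<psi> has_derivative (\<lambda>h. a * fst h + b * snd h)) (at (0, 0))"
begin

text \<open>For u and v of modulus at most 1, the restriction to the line through 0 in direction (u,
  v) is a self-map of the disc fixing 0, with derivative a u + b v there. The three claims are the
  one-variable Schwarz lemma and its equality case.\<close>

lemma slice:
  assumes "cmod u \<le> 1" "cmod v \<le> 1"
  shows "cmod \<zeta> < 1 \<Longrightarrow> cmod (\<psi> (\<zeta> * u, \<zeta> * v)) \<le> cmod \<zeta>"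
    and "cmod (a * u + b * v) \<le> 1"
    and "cmod (a * u + b * v) = 1 \<Longrightarrow> cmod \<zeta> < 1 \<Longrightarrow> \<psi> (\<zeta> * u, \<zeta> * v) = (a * u + b * v) * \<zeta>"
proof -
  define g where "g \<zeta> = \<psi> (\<zeta> * u, \<zeta> * v)" for \<zeta>
  have mem: "(\<zeta> * u, \<zeta> * v) \<in> bidisc" if "cmod \<zeta> < 1" for \<zeta>
    using mult_left_le[OF assms(1), of "cmod \<zeta>"] mult_left_le[OF assms(2), of "cmod \<zeta>"] that
    by (simp add: bidisc_def norm_mult)
  have holg: "g holomorphic_on ball 0 1"
    unfolding g_def using slice_holomorphic[OF hol, of "ball 0 1" 0 u 0 v] mem by simp
  have g: "g 0 = 0" "\<And>\<zeta>. cmod \<zeta> < 1 \<Longrightarrow> cmod (g \<zeta>) < 1"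
    using zero less_1 mem by (simp_all add: g_def)
  have dg: "(g has_field_derivative (a * u + b * v)) (at 0)"
    unfolding g_def using slice_has_field_derivative[of \<psi> a b 0 0 u 0 v] derivative by simp
  then have deriv: "deriv g 0 = a * u + b * v"
    by (rule DERIV_imp_deriv)
  show "cmod \<zeta> < 1 \<Longrightarrow> cmod (\<psi> (\<zeta> * u, \<zeta> * v)) \<le> cmod \<zeta>"
    using Schwarz_Lemma(1)[OF holg g, of \<zeta>] by (simp add: g_def)
  show "cmod (a * u + b * v) \<le> 1"
    using Schwarz_Lemma(2)[OF holg g, of 0] by (simp add: deriv)
  assume eq1: "cmod (a * u + b * v) = 1" and \<zeta>: "cmod \<zeta> < 1"
  obtain \<alpha> where \<alpha>: "\<And>z. cmod z < 1 \<Longrightarrow> g z = \<alpha> * z"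
    using Schwarz_Lemma(3)[OF holg g, of 0] eq1 by (auto simp: deriv)
  have "((\<lambda>z. \<alpha> * z) has_field_derivative (a * u + b * v)) (at 0)"
    using dg by (rule has_field_derivative_transform_within_open[of _ _ _ "ball 0 1"]) (auto simp: \<alpha>)
  moreover have "((\<lambda>z. \<alpha> * z) has_field_derivative \<alpha>) (at 0)"
    by (auto intro!: derivative_eq_intros)
  ultimately have "\<alpha> = a * u + b * v"
    by (rule DERIV_unique[symmetric])
  then show "\<psi> (\<zeta> * u, \<zeta> * v) = (a * u + b * v) * \<zeta>"
    using \<alpha>[OF \<zeta>] by (simp add: g_def)
qed

text \<open>The direction made of the conjugate signs of a and b turns a u + b v into the sum of the
  moduli; \<open>sgn 0 = 0\<close> is still admissible.\<close>

lemma norm_derivative_le: "cmod a + cmod b \<le> 1"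
proof -
  have *: "x * cnj (sgn x) = of_real (cmod x)" for x
  proof -
    have "x * cnj (sgn x) = x * cnj x / of_real (cmod x)"
      by (simp add: sgn_eq)
    also have "\<dots> = of_real ((cmod x)\<^sup>2) / of_real (cmod x)"
      by (simp only: complex_norm_square)
    finally show ?thesis
      by (simp add: power2_eq_square)
  qed
  have "a * cnj (sgn a) + b * cnj (sgn b) = of_real (cmod a + cmod b)"
    by (simp add: *)
  moreover have "cmod (cnj (sgn a)) \<le> 1" "cmod (cnj (sgn b)) \<le> 1"
    by (simp_all add: norm_sgn)
  ultimately show ?thesis
    using slice(2)[of "cnj (sgn a)" "cnj (sgn b)"] by (simp del: of_real_add)
qed

text \<open>Squaring \<open>norm_derivative_le\<close> leaves no room for the cross term 2 |a|
  |b|.\<close>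

lemma coordinate_rigidity:
  assumes "1 \<le> (cmod a)\<^sup>2 + (cmod b)\<^sup>2"
  shows "\<exists>pr\<in>{fst, snd}. \<exists>e\<in>sphere 0 1. \<forall>z\<in>bidisc. \<psi> z = e * pr z"
proof -
  have "(cmod a + cmod b)\<^sup>2 \<le> 1"
    using norm_derivative_le by (simp add: power_le_one)
  with assms have "2 * (cmod a * cmod b) \<le> 0"
    by (simp add: power2_sum)
  then have "a = 0 \<or> b = 0"
    by (auto simp: mult_le_0_iff)
  moreover have "1 \<le> cmod b" if "a = 0"
    using that assms by (intro power2_le_imp_le[of 1 "cmod b"]) simp_all
  moreover have "1 \<le> cmod a" if "b = 0"
    using that assms by (intro power2_le_imp_le[of 1 "cmod a"]) simp_all
  ultimately consider "cmod a = 1" "b = 0" | "cmod b = 1" "a = 0"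
    using norm_derivative_le by auto
  then show ?thesis
  proof cases
    case 1
    have "\<psi> z = a * fst z" if z: "z \<in> bidisc" for z
    proof -
      obtain z1 w where zw: "z = (z1, w)" "cmod z1 < 1" "cmod w < 1"
        using z by (auto simp: bidisc_def)
      \<comment> \<open>The equality case of \<open>slice\<close> reaches (\<zeta>, w) along the
        direction (1, w / \<zeta>), which is admissible only if \<zeta> has at least the modulus of
        w. The identity thus holds on an annulus and extends to the disc by analytic
        continuation.\<close>
      define S where "S = ball 0 1 - cball (0::complex) (cmod w)"
      have "of_real ((1 + cmod w) / 2) \<in> S"
        using zw by (simp add: S_def del: of_real_divide of_real_add)
      then have "S \<noteq> {}"
        by blast
      moreover have "S \<subseteq> ball 0 1"
        by (auto simp: S_def)
      moreover have "open S"
        by (simp add: S_def open_Diff)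
      moreover have "(\<lambda>\<zeta>. \<psi> (\<zeta>, w)) holomorphic_on ball 0 1"
        using slice_holomorphic[OF hol, of "ball 0 1" 0 1 w 0] zw by (simp add: bidisc_def)
      moreover have "(\<lambda>\<zeta>. a * \<zeta>) holomorphic_on ball 0 1"
        by (intro holomorphic_intros)
      moreover have "\<psi> (\<zeta>, w) = a * \<zeta>" if "\<zeta> \<in> S" for \<zeta>
        using slice(3)[of 1 "w / \<zeta>" \<zeta>] that 1 by (cases "\<zeta> = 0") (auto simp: S_def norm_divide divide_simps)
      ultimately have "\<psi> (z1, w) = a * z1"
        using zw by (intro analytic_continuation_open[of S "ball 0 1" "\<lambda>\<zeta>. \<psi> (\<zeta>, w)" "\<lambda>\<zeta>. a * \<zeta>" z1])
          auto
      then show ?thesis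
        by (simp add: zw)
    qed
    then show ?thesis
      using 1 by (intro bexI[of _ fst] bexI[of _ a]) auto
  next
    case 2
    have "\<psi> z = b * snd z" if z: "z \<in> bidisc" for z
    proof -
      obtain w z2 where zw: "z = (w, z2)" "cmod z2 < 1" "cmod w < 1"
        using z by (auto simp: bidisc_def)
      define S where "S = ball 0 1 - cball (0::complex) (cmod w)"
      have "of_real ((1 + cmod w) / 2) \<in> S"
        using zw by (simp add: S_def del: of_real_divide of_real_add)
      then have "S \<noteq> {}"
        by blast
      moreover have "S \<subseteq> ball 0 1"
        by (auto simp: S_def)
      moreover have "open S"
        by (simp add: S_def open_Diff)
      moreover have "(\<lambda>\<zeta>. \<psi> (w, \<zeta>)) holomorphic_on ball 0 1"
        using slice_holomorphic[OF hol, of "ball 0 1" w 0 0 1] zw by (simp add: bidisc_def)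
      moreover have "(\<lambda>\<zeta>. b * \<zeta>) holomorphic_on ball 0 1"
        by (intro holomorphic_intros)
      moreover have "\<psi> (w, \<zeta>) = b * \<zeta>" if "\<zeta> \<in> S" for \<zeta>
        using slice(3)[of "w / \<zeta>" 1 \<zeta>] that 2 by (cases "\<zeta> = 0") (auto simp: S_def norm_divide divide_simps)
      ultimately have "\<psi> (w, z2) = b * z2"
        using zw by (intro analytic_continuation_open[of S "ball 0 1" "\<lambda>\<zeta>. \<psi> (w, \<zeta>)" "\<lambda>\<zeta>. b * \<zeta>" z2])
          auto
      then show ?thesis
        by (simp add: zw)
    qed
    then show ?thesis
      using 2 by (intro bexI[of _ snd] bexI[of _ b]) auto
  qed
qed

end

text \<open>Expand \<open>1 / (1 - P P\<^sup>*)\<close> as a geometric series; every summand of the resulting quadratic form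
  splits into four forms of rank one.\<close>

lemma psd_on_geometric_series:
  fixes X Y P c :: "'i \<Rightarrow> complex"
  assumes "finite I"
    and psd: "psd_on I (\<lambda>z w. 1 - (1 - X z * cnj (X w)) * (1 - Y z * cnj (Y w)) / (1 - P z * cnj (P w)))"
    and P: "\<And>z. z \<in> I \<Longrightarrow> cmod (P z) < 1"
    and c: "(\<Sum>z\<in>I. cnj (c z)) = 0"
  defines "A \<equiv> \<lambda>f. (cmod (\<Sum>z\<in>I. cnj (c z) * f z))\<^sup>2"
  shows "\<exists>Q\<le>0. (\<lambda>k. A (\<lambda>z. P z ^ k) + A (\<lambda>z. X z * Y z * P z ^ k)
    - (A (\<lambda>z. X z * P z ^ k) + A (\<lambda>z. Y z * P z ^ k))) sums Q"
proof -
  define M where "M z w = (1 - X z * cnj (X w)) * (1 - Y z * cnj (Y w)) / (1 - P z * cnj (P w))" for z w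
  define T where "T k z w = (1 - X z * cnj (X w)) * (1 - Y z * cnj (Y w)) * (P z * cnj (P w)) ^ k" for k z w
  define Q where "Q = (\<Sum>z\<in>I. \<Sum>w\<in>I. cnj (c z) * M z w * c w)"
  have TM: "(\<lambda>k. T k z w) sums M z w" if "z \<in> I" "w \<in> I" for z w
  proof -
    have "cmod (P z * cnj (P w)) < 1"
      using P[OF that(1)] P[OF that(2)] by (simp add: norm_mult) (metis mult_strict_mono' mult_1 norm_ge_zero)
    from sums_mult[OF geometric_sums[OF this], of "(1 - X z * cnj (X w)) * (1 - Y z * cnj (Y w))"] show ?thesis
      by (simp add: T_def M_def)
  qed
  have rank: "(\<Sum>z\<in>I. \<Sum>w\<in>I. cnj (c z) * (f z * cnj (f w)) * c w) = of_real (A f)" for f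
    unfolding A_def by (rule sum_rank_one)
  have "(\<lambda>k. \<Sum>z\<in>I. \<Sum>w\<in>I. cnj (c z) * T k z w * c w) sums Q"
    unfolding Q_def by (intro sums_sum sums_mult sums_mult2 TM)
  moreover have "(\<Sum>z\<in>I. \<Sum>w\<in>I. cnj (c z) * T k z w * c w)
    = of_real (A (\<lambda>z. P z ^ k) + A (\<lambda>z. X z * Y z * P z ^ k) - (A (\<lambda>z. X z * P z ^ k) + A (\<lambda>z. Y z * P z ^ k)))" for k
    unfolding of_real_diff of_real_add rank[symmetric] sum.distrib[symmetric] sum_subtractf[symmetric]
    by (intro sum.cong refl) (simp add: T_def algebra_simps power_mult_distrib)
  ultimately have sums: "(\<lambda>k. complex_of_real (A (\<lambda>z. P z ^ k) + A (\<lambda>z. X z * Y z * P z ^ k)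
      - (A (\<lambda>z. X z * P z ^ k) + A (\<lambda>z. Y z * P z ^ k)))) sums Q"
    by simp
  \<comment> \<open>The constant kernel 1 contributes the squared modulus of the sum of all
    \<open>cnj (c z)\<close>, which is 0, so only - Q remains.\<close>
  have "0 \<le> (\<Sum>z\<in>I. \<Sum>w\<in>I. cnj (c z) * (1 - M z w) * c w)"
    using psd_onD[OF psd, of c] by (simp add: M_def)
  also have "\<dots> = (\<Sum>z\<in>I. \<Sum>w\<in>I. cnj (c z) * (1 * cnj 1) * c w) - Q"
    unfolding Q_def sum_subtractf[symmetric] by (simp add: algebra_simps)
  also have "\<dots> = - Q"
    using rank[of "\<lambda>_. 1"] c by (simp add: A_def)
  finally have "Re Q \<le> 0"
    by (simp add: less_eq_complex_def)
  with sums_Re[OF sums] show ?thesis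
    by (auto simp del: of_real_add of_real_diff)
qed

context bidisc_schwarz
begin

text \<open>The mixed second difference \<open>S\<close> over the four points \<open>(\<plusminus>t, \<plusminus>t)\<close> annihilates \<open>1\<close>, \<open>z\<^sub>1\<close> and \<open>z\<^sub>2\<close>,
  so in the geometric series only the term \<open>z\<^sub>1 z\<^sub>2\<close> with \<open>k = 0\<close> and the terms \<open>z\<^sub>1 \<psi>\<close>, \<open>z\<^sub>2 \<psi>\<close>
  with \<open>k = 1\<close> matter to order \<open>t\<^sup>4\<close>.\<close>

lemma second_difference_estimate:
  fixes t \<epsilon> :: real
  assumes psd: "\<And>I. finite I \<Longrightarrow> I \<subseteq> bidisc - {(0, 0)} \<Longrightarrow>
      psd_on I (\<lambda>z w. 1 - (1 - fst z * cnj (fst w)) * (1 - snd z * cnj (snd w)) / (1 - \<psi> z * cnj (\<psi> w)))"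
    and t: "0 < t" "t \<le> 1/2"
    and \<epsilon>: "\<And>z. norm z \<le> 2 * t \<Longrightarrow> cmod (\<psi> z - (a * fst z + b * snd z)) \<le> \<epsilon> * norm z"
    and "0 \<le> \<epsilon>"
  shows "1 \<le> (cmod a + 2 * \<epsilon>)\<^sup>2 + (cmod b + 2 * \<epsilon>)\<^sup>2 + 4 * t\<^sup>2"
proof -
  \<comment> \<open>The sign patterns are the index set, the product of the two signs is the weight
    in the difference, and X and Y scale the pattern to the actual point.\<close>
  define I :: "(complex \<times> complex) set" where "I = {1, -1} \<times> {1, -1}"
  define X Y where "X z = of_real t * fst z" and "Y z = of_real t * snd z" for z :: "complex \<times> complex"
  define P where "P z = \<psi> (X z, Y z)" for z
  define S where "S f = (\<Sum>z\<in>I. cnj (fst z * snd z) * f z)" for f :: "complex \<times> complex \<Rightarrow> complex"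
  have Sf: "S f = f (1, 1) - f (1, -1) - f (-1, 1) + f (-1, -1)" for f
    by (simp add: S_def I_def sum.cartesian_product[symmetric])
  have Ione: "cmod (fst z) = 1" "cmod (snd z) = 1" if "z \<in> I" for z
    using that by (auto simp: I_def)
  have finI: "finite I"
    by (simp add: I_def)
  have S_le: "cmod (S f) \<le> 4 * B" if "\<And>z. z \<in> I \<Longrightarrow> cmod (f z) \<le> B" for f B
  proof -
    have "cmod (S f) \<le> (\<Sum>z\<in>I. B)"
      unfolding S_def by (intro sum_norm_le) (simp add: norm_mult Ione that)
    then show ?thesis by (simp add: I_def)
  qed
  have P_le: "cmod (P z) \<le> t" if "z \<in> I" for z
    using slice(1)[of "fst z" "snd z" "of_real t"] Ione[OF that] t by (simp add: P_def X_def Y_def)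
  let ?h = "\<lambda>z. (X z, Y z)"
  have "inj_on ?h I"
    using t by (auto simp: inj_on_def X_def Y_def)
  moreover have "?h ` I \<subseteq> bidisc - {(0, 0)}"
    using t by (auto simp: I_def bidisc_def X_def Y_def)
  ultimately have "psd_on I (\<lambda>z w. 1 - (1 - X z * cnj (X w)) * (1 - Y z * cnj (Y w)) / (1 - P z * cnj (P w)))"
    using psd_on_reindex[of ?h I] psd[of "?h ` I"] finI by (simp add: P_def)
  moreover have "cmod (P z) < 1" if "z \<in> I" for z
    using P_le[OF that] t by simp
  moreover have "(\<Sum>z\<in>I. cnj (fst z * snd z)) = 0"
    using Sf[of "\<lambda>_. 1"] by (simp add: S_def)
  ultimately obtain Q where Q: "Q \<le> 0" and sumsQ: "(\<lambda>k. ((cmod (S (\<lambda>z. P z ^ k)))\<^sup>2 + (cmod (S (\<lambda>z. X z * Y z * P z ^ k)))\<^sup>2)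
      - ((cmod (S (\<lambda>z. X z * P z ^ k)))\<^sup>2 + (cmod (S (\<lambda>z. Y z * P z ^ k)))\<^sup>2)) sums Q"
    using psd_on_geometric_series[OF finI, of X Y P "\<lambda>z. fst z * snd z"] unfolding S_def by blast
  define T R where "T k = (cmod (S (\<lambda>z. P z ^ k)))\<^sup>2 + (cmod (S (\<lambda>z. X z * Y z * P z ^ k)))\<^sup>2"
    and "R k = (cmod (S (\<lambda>z. X z * P z ^ k)))\<^sup>2 + (cmod (S (\<lambda>z. Y z * P z ^ k)))\<^sup>2" for k
  have TR: "(\<lambda>k. T k - R k) sums Q"
    using sumsQ by (simp add: T_def R_def)
  have T_nonneg: "0 \<le> T k" for k
    by (simp add: T_def)
  have T0: "16 * t ^ 4 \<le> T 0"
  proof -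
    have "S (\<lambda>z. X z * Y z * P z ^ 0) = of_real (4 * t\<^sup>2)"
      by (simp add: Sf X_def Y_def power2_eq_square)
    then have "cmod (S (\<lambda>z. X z * Y z * P z ^ 0)) = 4 * t\<^sup>2"
      by (simp only: norm_of_real) simp
    then have "(cmod (S (\<lambda>z. X z * Y z * P z ^ 0)))\<^sup>2 = 16 * t ^ 4"
      by (simp add: power_mult_distrib flip: power_mult)
    then show ?thesis
      unfolding T_def by (metis add_increasing zero_le_power2 order_refl)
  qed
  have R0: "R 0 = 0"
    by (simp add: R_def Sf X_def Y_def)
  \<comment> \<open>By the Schwarz lemma \<psi> has modulus at most t at the four points. So the
    terms with k at least 2 add up to order t^6, below the leading order t^4.\<close>
  have R_le: "R k \<le> 32 * t\<^sup>2 * (t\<^sup>2) ^ k" for k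
  proof -
    have "cmod (X z * P z ^ k) \<le> t * t ^ k" "cmod (Y z * P z ^ k) \<le> t * t ^ k" if "z \<in> I" for z
      using t power_mono[OF P_le[OF that] norm_ge_zero, of k] Ione[OF that]
      by (simp_all add: norm_mult norm_power X_def Y_def)
    then have "cmod (S (\<lambda>z. X z * P z ^ k)) \<le> 4 * (t * t ^ k)" "cmod (S (\<lambda>z. Y z * P z ^ k)) \<le> 4 * (t * t ^ k)"
      by (intro S_le; simp)+
    then have "R k \<le> (4 * (t * t ^ k))\<^sup>2 + (4 * (t * t ^ k))\<^sup>2"
      unfolding R_def by (intro add_mono power_mono) auto
    also have "\<dots> = 32 * t\<^sup>2 * (t\<^sup>2) ^ k"
      by (simp add: power_mult_distrib power2_eq_square)
    finally show ?thesis .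
  qed
  define E where "E z = P z - (a * X z + b * Y z)" for z
  have E_le: "cmod (E z) \<le> \<epsilon> * (2 * t)" if "z \<in> I" for z
  proof -
    have "norm (X z, Y z) \<le> cmod (X z) + cmod (Y z)"
      by (rule norm_Pair_le)
    then have "norm (X z, Y z) \<le> 2 * t"
      using Ione[OF that] t by (simp add: X_def Y_def norm_mult)
    then show ?thesis
      using \<epsilon>[of "(X z, Y z)"] mult_left_mono[OF _ \<open>0 \<le> \<epsilon>\<close>, of "norm (X z, Y z)" "2 * t"]
      by (simp add: E_def P_def)
  qed
  have "cmod (S (\<lambda>z. X z * P z)) \<le> 4 * t\<^sup>2 * (cmod b + 2 * \<epsilon>)"
  proof -
    \<comment> \<open>In X (a X + b Y) the square of X is constant and annihilated, while X Y is t^2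
      times the weight of the difference and yields 4 t^2 b.\<close>
    have "S (\<lambda>z. X z * P z) = of_real (4 * t\<^sup>2) * b + S (\<lambda>z. X z * E z)"
      by (simp add: Sf E_def X_def Y_def algebra_simps power2_eq_square)
    moreover have "cmod (S (\<lambda>z. X z * E z)) \<le> 4 * (t * (\<epsilon> * (2 * t)))"
      using t by (intro S_le) (simp add: norm_mult X_def Ione E_le)
    ultimately show ?thesis
      using norm_triangle_ineq[of "of_real (4 * t\<^sup>2) * b" "S (\<lambda>z. X z * E z)"]
      by (simp add: norm_mult algebra_simps power2_eq_square)
  qed
  moreover have "cmod (S (\<lambda>z. Y z * P z)) \<le> 4 * t\<^sup>2 * (cmod a + 2 * \<epsilon>)"
  proof -
    have "S (\<lambda>z. Y z * P z) = of_real (4 * t\<^sup>2) * a + S (\<lambda>z. Y z * E z)"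
      by (simp add: Sf E_def X_def Y_def algebra_simps power2_eq_square)
    moreover have "cmod (S (\<lambda>z. Y z * E z)) \<le> 4 * (t * (\<epsilon> * (2 * t)))"
      using t by (intro S_le) (simp add: norm_mult Y_def Ione E_le)
    ultimately show ?thesis
      using norm_triangle_ineq[of "of_real (4 * t\<^sup>2) * a" "S (\<lambda>z. Y z * E z)"]
      by (simp add: norm_mult algebra_simps power2_eq_square)
  qed
  ultimately have "R 1 \<le> (4 * t\<^sup>2 * (cmod b + 2 * \<epsilon>))\<^sup>2 + (4 * t\<^sup>2 * (cmod a + 2 * \<epsilon>))\<^sup>2"
    unfolding R_def power_one_right by (intro add_mono power_mono) auto
  moreover have "(4 * t\<^sup>2 * x)\<^sup>2 = 16 * t ^ 4 * x\<^sup>2" for x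
    by (simp add: power_mult_distrib flip: power_mult)
  ultimately have "R 1 \<le> 16 * t ^ 4 * (cmod b + 2 * \<epsilon>)\<^sup>2 + 16 * t ^ 4 * (cmod a + 2 * \<epsilon>)\<^sup>2"
    by (simp only:)
  then have R1: "R 1 \<le> 16 * t ^ 4 * ((cmod a + 2 * \<epsilon>)\<^sup>2 + (cmod b + 2 * \<epsilon>)\<^sup>2)"
    by (simp only: distrib_left add.commute)
  \<comment> \<open>The bound on \<open>R\<close> is geometric with value 32 t^6 at k = 2. The
    factor 1 / (1 - t^2), at most 2, makes it 64 t^6, which is the summand 4 t^2 after division by
    16 t^4.\<close>
  have tail: "(\<lambda>k. T (k + 2) - R (k + 2)) sums (Q - (\<Sum>k<2. T k - R k))"
    by (rule sums_split_initial_segment[OF TR])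
  have t2: "t\<^sup>2 < 1" "1 / (1 - t\<^sup>2) \<le> 2"
    using t power_mono[of t "1/2" 2] by (auto simp: power2_eq_square field_simps)
  have geom: "(\<lambda>k. - (32 * t ^ 6) * (t\<^sup>2) ^ k) sums (- (32 * t ^ 6) * (1 / (1 - t\<^sup>2)))"
    using t2 by (intro sums_mult geometric_sums) simp
  have geom_le: "- (32 * t ^ 6) * (t\<^sup>2) ^ k \<le> T (k + 2) - R (k + 2)" for k
  proof -
    have "t ^ 6 = t\<^sup>2 * (t\<^sup>2)\<^sup>2"
      by (simp flip: power_add power_mult)
    then have "32 * t ^ 6 * (t\<^sup>2) ^ k = 32 * t\<^sup>2 * (t\<^sup>2) ^ (k + 2)"
      unfolding power_add by simp
    then have "R (k + 2) \<le> 32 * t ^ 6 * (t\<^sup>2) ^ k"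
      using R_le[of "k + 2"] by (simp only:)
    then show ?thesis
      using T_nonneg[of "k + 2"] by simp
  qed
  have "- (32 * t ^ 6) * (1 / (1 - t\<^sup>2)) \<le> Q - (\<Sum>k<2. T k - R k)"
    by (rule sums_le[OF geom_le geom tail])
  moreover have "32 * t ^ 6 * (1 / (1 - t\<^sup>2)) \<le> 32 * t ^ 6 * 2"
    using t2 by (intro mult_left_mono) auto
  moreover have "(\<Sum>k<2. T k - R k) = T 0 + (T 1 - R 1)"
    by (simp add: numeral_2_eq_2 R0)
  ultimately have "T 0 \<le> R 1 + 64 * t ^ 6"
    using Q T_nonneg[of 1] by linarith
  moreover have "64 * t ^ 6 = 16 * t ^ 4 * (4 * t\<^sup>2)"
    by (simp flip: power_add)
  ultimately have "16 * t ^ 4 * 1 \<le> 16 * t ^ 4 * ((cmod a + 2 * \<epsilon>)\<^sup>2 + (cmod b + 2 * \<epsilon>)\<^sup>2 + 4 * t\<^sup>2)"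
    using T0 R1 by (simp only: distrib_left)
  then show ?thesis
    using t by (subst (asm) mult_le_cancel_left_pos) auto
qed

text \<open>Differentiability at the origin supplies a t for every \<epsilon>, and both are sent to
  0 in \<open>second_difference_estimate\<close>.\<close>

lemma derivative_norm_ge:
  assumes psd: "\<And>I. finite I \<Longrightarrow> I \<subseteq> bidisc - {(0, 0)} \<Longrightarrow>
      psd_on I (\<lambda>z w. 1 - (1 - fst z * cnj (fst w)) * (1 - snd z * cnj (snd w)) / (1 - \<psi> z * cnj (\<psi> w)))"
  shows "1 \<le> (cmod a)\<^sup>2 + (cmod b)\<^sup>2"
proof -
  have ab: "cmod a \<le> 1" "cmod b \<le> 1"
    using norm_derivative_le norm_ge_zero[of a] norm_ge_zero[of b] by linarith+
  \<comment> \<open>Each square costs at most 6 \<epsilon> and 4 t^2 costs at most 4 \<epsilon>: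
    together 16 \<epsilon>, rounded up. Taking \<epsilon> at most \<delta> / 40 below keeps the loss
    under \<delta> / 2.\<close>
  have est: "1 \<le> (cmod a)\<^sup>2 + (cmod b)\<^sup>2 + 20 * \<epsilon>" if \<epsilon>: "0 < \<epsilon>" "\<epsilon> \<le> 1/2" for \<epsilon>
  proof -
    obtain d where d: "0 < d" "\<And>z. norm z < d \<Longrightarrow> cmod (\<psi> z - (a * fst z + b * snd z)) \<le> \<epsilon> * norm z"
      using derivative \<epsilon>(1) zero unfolding has_derivative_at_alt by (auto simp: zero_prod_def)
    define t where "t = min \<epsilon> (d / 3)"
    have t: "0 < t" "t \<le> 1/2" "t \<le> \<epsilon>" "2 * t < d"
      using \<epsilon> d(1) by (auto simp: t_def)
    have "1 \<le> (cmod a + 2 * \<epsilon>)\<^sup>2 + (cmod b + 2 * \<epsilon>)\<^sup>2 + 4 * t\<^sup>2"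
      using \<epsilon> t d(2) by (intro second_difference_estimate[OF psd]) auto
    moreover have sq: "(x + 2 * \<epsilon>)\<^sup>2 \<le> x\<^sup>2 + 6 * \<epsilon>" if "x \<le> 1" for x :: real
    proof -
      have "x * \<epsilon> \<le> 1 * \<epsilon>" "\<epsilon> * \<epsilon> \<le> \<epsilon> * (1 / 2)"
        using \<epsilon> that by (intro mult_right_mono mult_left_mono; simp)+
      then show ?thesis
        by (simp add: power2_eq_square algebra_simps)
    qed
    moreover have "t\<^sup>2 \<le> 1 * \<epsilon>"
      using t unfolding power2_eq_square by (intro mult_mono) auto
    ultimately show ?thesis
      using sq[OF ab(1)] sq[OF ab(2)] \<epsilon>(1) by linarith
  qed
  show ?thesis
  proof (rule ccontr)
    define \<delta> where "\<delta> = 1 - ((cmod a)\<^sup>2 + (cmod b)\<^sup>2)"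
    define m where "m = min (1/2) (\<delta> / 40)"
    assume "\<not> ?thesis"
    then have "0 < \<delta>"
      unfolding \<delta>_def by linarith
    then have m: "0 < m" "m \<le> 1/2" "m \<le> \<delta> / 40"
      by (simp_all add: m_def)
    show False
      using est[OF m(1,2)] m(3) \<open>0 < \<delta>\<close> \<delta>_def by linarith
  qed
qed

end

section \<open>Disc automorphisms and the necessity of the coordinate form\<close>

lemma one_minus_mult_cnj_nonzero:
  assumes "cmod z < 1" "cmod w < 1"
  shows "1 - z * cnj w \<noteq> 0"
proof
  assume "1 - z * cnj w = 0"
  then have "cmod z * cmod w = 1"
    using norm_mult[of z "cnj w"] by simp
  with assms show False
    using mult_strict_mono'[of "cmod z" 1 "cmod w" 1] by simp
qed

text \<open>Both directions rest on this identity: applied to values of \<phi> it replaces \<phi> by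
  \<psi> in the normalised kernel, and applied to a coordinate it exposes the Szego denominator that
  cancels.\<close>

lemma one_minus_disc_aut_mult_cnj:
  assumes "cmod \<mu> < 1" "cmod z < 1" "cmod w < 1"
  shows "1 - disc_aut \<mu> z * cnj (disc_aut \<mu> w)
    = (1 - \<mu> * cnj \<mu>) * (1 - z * cnj w) / ((1 - z * cnj \<mu>) * (1 - \<mu> * cnj w))"
proof -
  have *: "1 - (p / D) * (q / E) = (D * E - p * q) / (D * E)" if "D \<noteq> 0" "E \<noteq> 0" for p q D E :: complex
    using that by (simp add: diff_divide_distrib)
  have "1 - z * cnj \<mu> \<noteq> 0" "1 - \<mu> * cnj w \<noteq> 0"
    using assms one_minus_mult_cnj_nonzero by auto
  then have "1 - disc_aut \<mu> z * cnj (disc_aut \<mu> w)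
    = ((1 - z * cnj \<mu>) * (1 - \<mu> * cnj w) - (z - \<mu>) * (cnj w - cnj \<mu>)) / ((1 - z * cnj \<mu>) * (1 - \<mu> * cnj w))"
    using *[of "1 - z * cnj \<mu>" "1 - \<mu> * cnj w" "z - \<mu>" "cnj w - cnj \<mu>"]
    by (simp add: disc_aut_def mult.commute[of "cnj \<mu>" z])
  also have "(1 - z * cnj \<mu>) * (1 - \<mu> * cnj w) - (z - \<mu>) * (cnj w - cnj \<mu>) = (1 - \<mu> * cnj \<mu>) * (1 - z * cnj w)"
    by (simp add: algebra_simps)
  finally show ?thesis .
qed

lemma cnp_kernel_imp_coordinate_aut:
  assumes \<phi>: "\<phi> \<in> H_inf_1_bidisc" and nc: "\<not> \<phi> constant_on bidisc"
    and cnp: "cnp_kernel bidisc (dbr_kernel \<phi>)"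
  shows "\<exists>\<mu>\<in>ball 0 1. \<exists>c\<in>sphere 0 1. \<exists>pr\<in>{fst, snd}. \<forall>z\<in>bidisc. \<phi> z = c * disc_aut \<mu> (pr z)"
proof -
  let ?K = "dbr_kernel \<phi>"
  obtain H ip where rk: "rkhs bidisc ?K H ip" and cs: "cnp_space bidisc ?K H ip"
    using cnp by (auto simp: cnp_kernel_def)
  interpret rkhs bidisc ?K H ip by (rule rk)
  note less = nonconstant_H_inf_norm_less[OF \<phi> nc]
  have bd: "cmod (fst z) < 1" "cmod (snd z) < 1" if "z \<in> bidisc" for z
    using that by (auto simp: bidisc_def)
  have z0: "(0, 0) \<in> bidisc"
    by (simp add: bidisc_def)
  define \<mu> where "\<mu> = \<phi> (0, 0)"
  have \<mu>: "cmod \<mu> < 1"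
    using less[OF z0] by (simp add: \<mu>_def)
  define \<psi> where "\<psi> z = disc_aut \<mu> (\<phi> z)" for z
  have nz: "1 - \<phi> z * cnj (\<phi> w) \<noteq> 0" if "z \<in> bidisc" "w \<in> bidisc" for z w
    using that less one_minus_mult_cnj_nonzero by blast
  have \<psi>_less: "cmod (\<psi> z) < 1" if "z \<in> bidisc" for z
    using Moebius_function_norm_lt_1[OF \<mu> less[OF that]] by (simp add: \<psi>_def disc_aut_eq_Moebius_function)
  have \<psi>_deriv: "\<exists>a b. (\<psi> has_derivative (\<lambda>h. a * fst h + b * snd h)) (at z)" if z: "z \<in> bidisc" for z
  proof -
    have "holomorphic2_on \<phi> bidisc"
      using \<phi> by (simp add: H_inf_1_bidisc_def)
    from holomorphic2_on_bidisc_at[OF this z]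
    obtain a b where ab: "(\<phi> has_derivative (\<lambda>h. a * fst h + b * snd h)) (at z)"
      by blast
    have "disc_aut \<mu> holomorphic_on ball 0 1"
      unfolding disc_aut_eq_Moebius_function by (rule Moebius_function_holomorphic[OF \<mu>])
    then have "disc_aut \<mu> field_differentiable at (\<phi> z)"
      using less[OF z] by (intro holomorphic_on_imp_differentiable_at[of _ "ball 0 1"]) auto
    then obtain d where "(disc_aut \<mu> has_field_derivative d) (at (\<phi> z))"
      unfolding field_differentiable_def by blast
    then have "(disc_aut \<mu> has_derivative (*) d) (at (\<phi> z))"
      by (simp add: has_field_derivative_def)
    from has_derivative_compose[OF ab this] have "(\<psi> has_derivative (\<lambda>h. (d * a) * fst h + (d * b) * snd h)) (at z)"
      by (simp add: \<psi>_def[abs_def] algebra_simps)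
    then show ?thesis by blast
  qed
  then obtain a b where ab: "(\<psi> has_derivative (\<lambda>h. a * fst h + b * snd h)) (at (0, 0))"
    using z0 by blast
  interpret S: bidisc_schwarz \<psi> a b
  proof
    show "holomorphic2_on \<psi> bidisc"
      unfolding holomorphic2_on_def using \<psi>_deriv has_derivative_at_withinI by blast
  qed (use \<psi>_less ab in \<open>simp_all add: \<psi>_def \<mu>_def disc_aut_def\<close>)
  have Knz: "?K z w \<noteq> 0" if "z \<in> bidisc" "w \<in> bidisc" for z w
    using nz[OF that] one_minus_mult_cnj_nonzero bd[OF that(1)] bd[OF that(2)]
    by (simp add: dbr_kernel_def szego2_def)
  have psd: "psd_on I (\<lambda>z w. 1 - (1 - fst z * cnj (fst w)) * (1 - snd z * cnj (snd w)) / (1 - \<psi> z * cnj (\<psi> w)))"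
    if I: "finite I" "I \<subseteq> bidisc - {(0, 0)}" for I
  proof -
    \<comment> \<open>The Szego kernel is 1 when one argument is the origin, so the normalisation
      affects only the factors with \<phi>, and these combine to the reciprocal of
      \<open>1 - \<psi> z * cnj (\<psi> w)\<close>.\<close>
    have eq: "1 - ?K z (0, 0) * ?K (0, 0) w / (?K z w * ?K (0, 0) (0, 0))
      = 1 - (1 - fst z * cnj (fst w)) * (1 - snd z * cnj (snd w)) / (1 - \<psi> z * cnj (\<psi> w))"
      if zw: "z \<in> I" "w \<in> I" for z w
    proof -
      have m: "z \<in> bidisc" "w \<in> bidisc"
        using zw I by auto
      have K0: "?K z (0, 0) = 1 - \<phi> z * cnj \<mu>" "?K (0, 0) w = 1 - \<mu> * cnj (\<phi> w)"
        "?K (0, 0) (0, 0) = 1 - \<mu> * cnj \<mu>"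
        by (simp_all add: dbr_kernel_def szego2_def \<mu>_def)
      show ?thesis
        unfolding \<psi>_def one_minus_disc_aut_mult_cnj[OF \<mu> less[OF m(1)] less[OF m(2)]] K0
        by (simp add: dbr_kernel_def szego2_def mult_ac)
    qed
    have "psd_on I (\<lambda>z w. 1 - ?K z (0, 0) * ?K (0, 0) w / (?K z w * ?K (0, 0) (0, 0)))"
      by (rule cnp_space_psd_on[OF cs Knz z0]) (use I in auto)
    then show ?thesis
      by (subst psd_on_cong[OF eq[symmetric]])
  qed
  from S.coordinate_rigidity[OF S.derivative_norm_ge[OF psd]]
  obtain pr e where pr: "pr \<in> {fst, snd}" and e: "e \<in> sphere 0 1" and \<psi>: "\<And>z. z \<in> bidisc \<Longrightarrow> \<psi> z = e * pr z"
    by blast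
  have ee: "e * cnj e = 1"
    using e complex_norm_square[of e] by simp
  have "\<phi> z = e * disc_aut (- (cnj e * \<mu>)) (pr z)" if z: "z \<in> bidisc" for z
  proof -
    have "\<phi> z = disc_aut (- \<mu>) (\<psi> z)"
      using Moebius_function_compose[of "- \<mu>" \<mu> "\<phi> z"] \<mu> less[OF z]
      by (simp add: \<psi>_def disc_aut_eq_Moebius_function)
    \<comment> \<open>The factor \<open>e * cnj e\<close>, equal to 1, is inserted so that e can be
      pulled out of the numerator, which moves the parameter to
      \<open>- (cnj e * \<mu>)\<close>.\<close>
    also have "\<dots> = (e * pr z + (e * cnj e) * \<mu>) / (1 + cnj \<mu> * (e * pr z))"
      by (simp add: \<psi>[OF z] disc_aut_def ee)
    also have "\<dots> = e * disc_aut (- (cnj e * \<mu>)) (pr z)"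
      by (simp add: disc_aut_def algebra_simps)
    finally show ?thesis .
  qed
  then show ?thesis
    using pr e \<mu> by (intro bexI[of _ "- (cnj e * \<mu>)"] bexI[of _ e] bexI[of _ pr]) (auto simp: norm_mult)
qed

section \<open>Contractive linear systems\<close>

lemma sum_diff_scaled:
  fixes f g h :: "'i \<Rightarrow> 'b::comm_ring_1"
  shows "(\<Sum>x\<in>X. (f x - c * g x) * h x) = (\<Sum>x\<in>X. f x * h x) - c * (\<Sum>x\<in>X. g x * h x)"
    and "(\<Sum>x\<in>X. h x * (f x - c * g x)) = (\<Sum>x\<in>X. h x * f x) - c * (\<Sum>x\<in>X. h x * g x)"
  by (simp_all add: algebra_simps sum_subtractf sum_distrib_left)

text \<open>The last two conjuncts, saying that \<open>S\<close> vanishes off the spans of the \<open>u\<close>s and of the \<open>v\<close>s,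
  only serve the induction.\<close>

lemma partial_isometry_exists:
  fixes u :: "'i \<Rightarrow> 'x \<Rightarrow> complex" and v :: "'i \<Rightarrow> 'y \<Rightarrow> complex"
  assumes "finite I" "finite X" "finite Y"
    and "\<forall>p\<in>I. \<forall>q\<in>I. (\<Sum>x\<in>X. u p x * cnj (u q x)) = (\<Sum>y\<in>Y. v p y * cnj (v q y))"
  shows "\<exists>S. (\<forall>p\<in>I. \<forall>y\<in>Y. (\<Sum>x\<in>X. u p x * S x y) = v p y) \<and>
    (\<forall>w. (\<Sum>x\<in>X. (cmod (\<Sum>y\<in>Y. S x y * w y))\<^sup>2) \<le> (\<Sum>y\<in>Y. (cmod (w y))\<^sup>2)) \<and>
    (\<forall>t. (\<forall>p\<in>I. (\<Sum>x\<in>X. t x * cnj (u p x)) = 0) \<longrightarrow> (\<forall>y\<in>Y. (\<Sum>x\<in>X. t x * S x y) = 0)) \<and>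
    (\<forall>w. (\<forall>p\<in>I. (\<Sum>y\<in>Y. v p y * w y) = 0) \<longrightarrow> (\<forall>x\<in>X. (\<Sum>y\<in>Y. S x y * w y) = 0))"
  using assms(1) assms(4)
proof (induction I arbitrary: u v rule: finite_induct)
  case empty
  show ?case
    by (rule exI[of _ "\<lambda>x y. 0"]) (simp add: sum_nonneg)
next
  case (insert a I)
  have gram: "(\<Sum>x\<in>X. u p x * cnj (u q x)) = (\<Sum>y\<in>Y. v p y * cnj (v q y))"
    if "p \<in> insert a I" "q \<in> insert a I" for p q
    using insert.prems that by blast
  define d where "d = (\<Sum>x\<in>X. (cmod (u a x))\<^sup>2)"
  have dX: "(\<Sum>x\<in>X. u a x * cnj (u a x)) = of_real d"
    by (simp only: d_def of_real_sum complex_norm_square)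
  then have dY: "(\<Sum>y\<in>Y. v a y * cnj (v a y)) = of_real d"
    using gram[of a a] by simp
  then have dY': "(\<Sum>y\<in>Y. (cmod (v a y))\<^sup>2) = d"
    by (simp only: of_real_sum complex_norm_square flip: of_real_eq_iff[where ?'a = complex])
  show ?case
  proof (cases "d = 0")
    case True
    have zero: "\<forall>x\<in>X. u a x = 0" "\<forall>y\<in>Y. v a y = 0"
      using True dY' assms(2,3) by (simp_all add: d_def sum_nonneg_eq_0_iff)
    show ?thesis
      using insert.IH[of u v] insert.prems zero by (simp cong: sum.cong)
  next
    case False
    then have dpos: "0 < d" 
      using sum_nonneg[of X "\<lambda>x. (cmod (u a x))\<^sup>2"] by (simp add: d_def)
    \<comment> \<open>Gram-Schmidt: equal Gram matrices give equal projection coefficients along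
      \<open>u a\<close> and along \<open>v a\<close>, so removing these components keeps the Gram
      matrices equal.\<close>
    define t where "t p = (\<Sum>x\<in>X. u p x * cnj (u a x)) / of_real d" for p
    have tX: "(\<Sum>x\<in>X. u p x * cnj (u a x)) = t p * of_real d" for p
      using False by (simp add: t_def)
    have tY: "(\<Sum>y\<in>Y. v p y * cnj (v a y)) = t p * of_real d" if "p \<in> I" for p
      using gram[of p a] tX that by simp
    define u' v' where "u' p x = u p x - t p * u a x" and "v' p y = v p y - t p * v a y" for p x y
    have u'a: "(\<Sum>x\<in>X. u' p x * cnj (u a x)) = 0" for p
      unfolding u'_def sum_diff_scaled dX tX[of p] by simp
    have v'a: "(\<Sum>y\<in>Y. v' p y * cnj (v a y)) = 0" if "p \<in> I" for p
      unfolding v'_def by (simp add: sum_diff_scaled tY[OF that] dY)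
    have ta: "(\<Sum>x\<in>X. u a x * cnj (u q x)) = cnj (t q) * of_real d" for q
      using arg_cong[OF tX[of q], of cnj] by (simp add: mult.commute)
    have tb: "(\<Sum>y\<in>Y. v a y * cnj (v q y)) = cnj (t q) * of_real d" if "q \<in> I" for q
      using arg_cong[OF tY[OF that], of cnj] by (simp add: mult.commute)
    have "(\<Sum>x\<in>X. u' p x * cnj (u' q x)) = (\<Sum>x\<in>X. u p x * cnj (u q x)) - t p * cnj (t q) * of_real d" for p q
    proof -
      have "(\<Sum>x\<in>X. u' p x * cnj (u' q x)) = (\<Sum>x\<in>X. u' p x * cnj (u q x))
          - cnj (t q) * (\<Sum>x\<in>X. u' p x * cnj (u a x))"
        by (simp add: u'_def[of q] sum_diff_scaled)
      also have "\<dots> = (\<Sum>x\<in>X. u p x * cnj (u q x)) - t p * (\<Sum>x\<in>X. u a x * cnj (u q x))"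
        by (simp add: u'a) (simp add: u'_def sum_diff_scaled)
      finally show ?thesis by (simp add: ta)
    qed
    moreover have "(\<Sum>y\<in>Y. v' p y * cnj (v' q y)) = (\<Sum>y\<in>Y. v p y * cnj (v q y)) - t p * cnj (t q) * of_real d"
      if "p \<in> I" "q \<in> I" for p q
    proof -
      have "(\<Sum>y\<in>Y. v' p y * cnj (v' q y)) = (\<Sum>y\<in>Y. v' p y * cnj (v q y))
          - cnj (t q) * (\<Sum>y\<in>Y. v' p y * cnj (v a y))"
        by (simp add: v'_def[of q] sum_diff_scaled)
      also have "\<dots> = (\<Sum>y\<in>Y. v p y * cnj (v q y)) - t p * (\<Sum>y\<in>Y. v a y * cnj (v q y))"
        by (simp add: v'a that) (simp add: v'_def sum_diff_scaled)
      finally show ?thesis by (simp add: tb that)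
    qed
    ultimately have "\<forall>p\<in>I. \<forall>q\<in>I. (\<Sum>x\<in>X. u' p x * cnj (u' q x)) = (\<Sum>y\<in>Y. v' p y * cnj (v' q y))"
      using gram by simp
    from insert.IH[of u' v', OF this] obtain S' where
      S1: "\<And>p y. p \<in> I \<Longrightarrow> y \<in> Y \<Longrightarrow> (\<Sum>x\<in>X. u' p x * S' x y) = v' p y" and
      S2: "\<And>w. (\<Sum>x\<in>X. (cmod (\<Sum>y\<in>Y. S' x y * w y))\<^sup>2) \<le> (\<Sum>y\<in>Y. (cmod (w y))\<^sup>2)" and
      S3: "\<And>r y. (\<And>p. p \<in> I \<Longrightarrow> (\<Sum>x\<in>X. r x * cnj (u' p x)) = 0) \<Longrightarrow> y \<in> Y \<Longrightarrow> (\<Sum>x\<in>X. r x * S' x y) = 0" and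
      S4: "\<And>w x. (\<And>p. p \<in> I \<Longrightarrow> (\<Sum>y\<in>Y. v' p y * w y) = 0) \<Longrightarrow> x \<in> X \<Longrightarrow> (\<Sum>y\<in>Y. S' x y * w y) = 0"
      by blast
    \<comment> \<open>\<open>S'\<close> is annihilated by \<open>u a\<close> from the left and by
      \<open>cnj (v a)\<close> from the right, so the rank-one map taking \<open>u a\<close> to
      \<open>v a\<close> can be added without interference.\<close>
    define S where "S x y = S' x y + cnj (u a x) * v a y / of_real d" for x y
    have Srow: "(\<Sum>x\<in>X. r x * S x y) = (\<Sum>x\<in>X. r x * S' x y) + (\<Sum>x\<in>X. r x * cnj (u a x)) * v a y / of_real d"
      for r y
      by (simp add: S_def distrib_left sum.distrib sum_distrib_right sum_divide_distrib mult.assoc)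
    have Scol: "(\<Sum>y\<in>Y. S x y * w y) = (\<Sum>y\<in>Y. S' x y * w y) + cnj (u a x) * (\<Sum>y\<in>Y. v a y * w y) / of_real d"
      for w x
      by (simp add: S_def distrib_right sum.distrib sum_distrib_left sum_divide_distrib mult.assoc)
    have uaS': "(\<Sum>x\<in>X. u a x * S' x y) = 0" if "y \<in> Y" for y
    proof (rule S3[OF _ that])
      fix p
      show "(\<Sum>x\<in>X. u a x * cnj (u' p x)) = 0"
        using arg_cong[OF u'a[of p], of cnj] by (simp add: mult.commute)
    qed
    have S'va: "(\<Sum>y\<in>Y. S' x y * cnj (v a y)) = 0" if "x \<in> X" for x
      by (rule S4[OF _ that]) (rule v'a)
    have "(\<Sum>x\<in>X. u p x * S x y) = v p y" if "p \<in> insert a I" "y \<in> Y" for p y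
    proof (cases "p = a")
      case True
      then show ?thesis
        using uaS'[OF that(2)] False by (simp add: Srow dX)
    next
      case False
      have "(\<Sum>x\<in>X. u p x * S' x y) = (\<Sum>x\<in>X. u' p x * S' x y) + t p * (\<Sum>x\<in>X. u a x * S' x y)"
        by (simp add: u'_def sum_diff_scaled)
      also have "\<dots> = v' p y"
        using S1 uaS' that False by simp
      finally show ?thesis
        using dpos by (simp add: Srow tX v'_def)
    qed
    moreover have "(\<Sum>x\<in>X. (cmod (\<Sum>y\<in>Y. S x y * w y))\<^sup>2) \<le> (\<Sum>y\<in>Y. (cmod (w y))\<^sup>2)" for w
    proof -
      define s where "s = (\<Sum>y\<in>Y. v a y * w y) / of_real d"
      \<comment> \<open>The input is split into a multiple of \<open>cnj (v a)\<close> and a part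
        orthogonal to it. Their images are orthogonal too, so Pythagoras on both sides reduces the
        bound to that for \<open>S'\<close>.\<close>
      define w' where "w' y = w y - s * cnj (v a y)" for y
      have vw': "(\<Sum>y\<in>Y. v a y * w' y) = 0"
        unfolding w'_def sum_diff_scaled dY using False by (simp add: s_def)
      have Sw: "(\<Sum>y\<in>Y. S x y * w y) = (\<Sum>y\<in>Y. S' x y * w' y) + s * cnj (u a x)" if "x \<in> X" for x
      proof -
        have "(\<Sum>y\<in>Y. S' x y * w' y) = (\<Sum>y\<in>Y. S' x y * w y) - s * (\<Sum>y\<in>Y. S' x y * cnj (v a y))"
          by (simp add: w'_def sum_diff_scaled)
        then show ?thesis
          using S'va[OF that] by (simp add: Scol s_def)
      qed
      define h where "h x = (\<Sum>y\<in>Y. S' x y * w' y)" for x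
      have pyth: "(\<Sum>x\<in>Z. (cmod (f x + s * cnj (g x)))\<^sup>2) = (\<Sum>x\<in>Z. (cmod (f x))\<^sup>2) + (cmod s)\<^sup>2 * (\<Sum>x\<in>Z. (cmod (g x))\<^sup>2)"
        if "(\<Sum>x\<in>Z. g x * f x) = 0" for f g :: "'z \<Rightarrow> complex" and Z
      proof -
        have "(cmod (f x + s * cnj (g x)))\<^sup>2 = (cmod (f x))\<^sup>2 + (cmod s)\<^sup>2 * (cmod (g x))\<^sup>2 + 2 * Re (cnj s * (g x * f x))" for x
          by (simp only: cmod_power2) (simp add: power2_eq_square algebra_simps)
        then have "(\<Sum>x\<in>Z. (cmod (f x + s * cnj (g x)))\<^sup>2) = (\<Sum>x\<in>Z. (cmod (f x))\<^sup>2) + (cmod s)\<^sup>2 * (\<Sum>x\<in>Z. (cmod (g x))\<^sup>2)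
            + 2 * Re (cnj s * (\<Sum>x\<in>Z. g x * f x))"
          by (simp only: sum.distrib sum_distrib_left Re_sum)
        with that show ?thesis by simp
      qed
      have "(\<Sum>x\<in>X. u a x * h x) = (\<Sum>y\<in>Y. (\<Sum>x\<in>X. u a x * S' x y) * w' y)"
        unfolding h_def sum_distrib_left sum_distrib_right by (subst sum.swap) (simp add: mult_ac)
      then have uh: "(\<Sum>x\<in>X. u a x * h x) = 0"
        by (simp add: uaS')
      have "(\<Sum>x\<in>X. (cmod (\<Sum>y\<in>Y. S x y * w y))\<^sup>2) = (\<Sum>x\<in>X. (cmod (h x + s * cnj (u a x)))\<^sup>2)"
        by (simp add: Sw h_def)
      also have "\<dots> = (\<Sum>x\<in>X. (cmod (h x))\<^sup>2) + (cmod s)\<^sup>2 * d"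
        by (simp add: pyth[OF uh] d_def)
      also have "\<dots> \<le> (\<Sum>y\<in>Y. (cmod (w' y))\<^sup>2) + (cmod s)\<^sup>2 * d"
        using S2[of w'] by (simp add: h_def)
      also have "\<dots> = (\<Sum>y\<in>Y. (cmod (w' y + s * cnj (v a y)))\<^sup>2)"
        by (simp add: pyth[OF vw'] dY')
      finally show ?thesis
        by (simp add: w'_def)
    qed
    moreover have "(\<Sum>x\<in>X. r x * S x y) = 0"
      if r: "\<And>p. p \<in> insert a I \<Longrightarrow> (\<Sum>x\<in>X. r x * cnj (u p x)) = 0" and y: "y \<in> Y" for r y
    proof -
      have "(\<Sum>x\<in>X. r x * cnj (u' p x)) = (\<Sum>x\<in>X. r x * cnj (u p x)) - cnj (t p) * (\<Sum>x\<in>X. r x * cnj (u a x))" for p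
        by (simp add: u'_def sum_diff_scaled)
      then have "(\<Sum>x\<in>X. r x * S' x y) = 0"
        by (intro S3 y) (simp add: r)
      then show ?thesis
        using r[of a] by (simp add: Srow)
    qed
    moreover have "(\<Sum>y\<in>Y. S x y * w y) = 0"
      if w: "\<And>p. p \<in> insert a I \<Longrightarrow> (\<Sum>y\<in>Y. v p y * w y) = 0" and x: "x \<in> X" for w x
    proof -
      have "(\<Sum>y\<in>Y. v' p y * w y) = (\<Sum>y\<in>Y. v p y * w y) - t p * (\<Sum>y\<in>Y. v a y * w y)" for p
        by (simp add: v'_def sum_diff_scaled)
      then have "(\<Sum>y\<in>Y. S' x y * w y) = 0"
        by (intro S4 x) (simp add: w)
      then show ?thesis
        using w[of a] by (simp add: Scol)
    qed
    ultimately show ?thesis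
      by (intro exI[of _ S]) blast
  qed
qed

section \<open>Energy balance and generating functions of linear systems\<close>

definition square_summable :: "(nat \<Rightarrow> complex) \<Rightarrow> bool" where
  "square_summable a \<longleftrightarrow> summable (\<lambda>k. (cmod (a k))\<^sup>2)"

lemma summable_bounded_power_series:
  fixes a :: "nat \<Rightarrow> complex"
  assumes "\<And>k. cmod (a k) \<le> C" "cmod z < 1"
  shows "summable (\<lambda>k. a k * z ^ k)"
proof (rule summable_comparison_test')
  show "summable (\<lambda>k. C * cmod z ^ k)"
    using assms(2) by (intro summable_mult summable_geometric) simp
  show "norm (a k * z ^ k) \<le> C * cmod z ^ k" for k
    using assms(1) by (simp add: norm_mult norm_power mult_right_mono)
qed

lemma square_summable_bounded:
  assumes "square_summable a"
  shows "cmod (a k) \<le> sqrt (\<Sum>k. (cmod (a k))\<^sup>2)"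
proof (rule real_le_rsqrt)
  show "(cmod (a k))\<^sup>2 \<le> (\<Sum>k. (cmod (a k))\<^sup>2)"
    using sum_le_suminf[of "\<lambda>k. (cmod (a k))\<^sup>2" "{k}"] assms by (simp add: square_summable_def)
qed

lemma summable_square_summable_power_series:
  assumes "square_summable a" "cmod z < 1"
  shows "summable (\<lambda>k. a k * z ^ k)"
  using summable_bounded_power_series square_summable_bounded assms by blast

text \<open>The discrete-time linear system with state \<open>x\<close>, input \<open>u\<close> and output \<open>y\<close> evolving by
  \<open>x' = A x + B u\<close>, \<open>y = C x + D u\<close>. An input is a family of sequences \<open>u t\<close>, indexed by the component \<open>t\<close>.\<close>

locale contractive_system =
  fixes N m n :: nat and A B C D :: "nat \<Rightarrow> nat \<Rightarrow> complex"
  assumes contraction: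
    "(\<Sum>x<N. (cmod ((\<Sum>y<N. A x y * w y) + (\<Sum>t<n. B x t * e t)))\<^sup>2)
      + (\<Sum>s<m. (cmod ((\<Sum>y<N. C s y * w y) + (\<Sum>t<n. D s t * e t)))\<^sup>2)
      \<le> (\<Sum>y<N. (cmod (w y))\<^sup>2) + (\<Sum>t<n. (cmod (e t))\<^sup>2)"
begin

primrec state :: "(nat \<Rightarrow> nat \<Rightarrow> complex) \<Rightarrow> nat \<Rightarrow> nat \<Rightarrow> complex" where
  "state u 0 x = 0"
| "state u (Suc k) x = (\<Sum>y<N. A x y * state u k y) + (\<Sum>t<n. B x t * u t k)"

definition response :: "(nat \<Rightarrow> nat \<Rightarrow> complex) \<Rightarrow> nat \<Rightarrow> nat \<Rightarrow> complex" where
  "response u s k = (\<Sum>y<N. C s y * state u k y) + (\<Sum>t<n. D s t * u t k)"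

text \<open>Stored plus emitted energy never exceeds the supplied energy: the contraction property
  at each time step telescopes from the zero initial state.\<close>

lemma energy_bound:
  "(\<Sum>x<N. (cmod (state u M x))\<^sup>2) + (\<Sum>k<M. \<Sum>s<m. (cmod (response u s k))\<^sup>2)
    \<le> (\<Sum>k<M. \<Sum>t<n. (cmod (u t k))\<^sup>2)"
proof (induction M)
  case (Suc M)
  then show ?case
    using contraction[of "state u M" "\<lambda>t. u t M"] by (simp add: response_def)
qed simp

context
  fixes u :: "nat \<Rightarrow> nat \<Rightarrow> complex"
  assumes u: "\<And>t. t < n \<Longrightarrow> square_summable (u t)"
begin

lemma input_energy_le:
  "(\<Sum>k<M. \<Sum>t<n. (cmod (u t k))\<^sup>2) \<le> (\<Sum>t<n. \<Sum>k. (cmod (u t k))\<^sup>2)"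
  by (subst sum.swap, intro sum_mono sum_le_suminf)
     (use u in \<open>auto simp: square_summable_def\<close>)

lemma response_energy_le: "(\<Sum>k<M. \<Sum>s<m. (cmod (response u s k))\<^sup>2) \<le> (\<Sum>t<n. \<Sum>k. (cmod (u t k))\<^sup>2)"
  using energy_bound[of u M] input_energy_le[of M]
    sum_nonneg[of "{..<N}" "\<lambda>x. (cmod (state u M x))\<^sup>2"] by simp

text \<open>The state energy need not decay, but its boundedness already makes the generating
  function converge in the open disc.\<close>

lemma state_bounded: "x < N \<Longrightarrow> cmod (state u k x) \<le> sqrt (\<Sum>t<n. \<Sum>k. (cmod (u t k))\<^sup>2)"
proof (rule real_le_rsqrt)
  assume "x < N"
  then have "(cmod (state u k x))\<^sup>2 \<le> (\<Sum>x<N. (cmod (state u k x))\<^sup>2)"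
    by (intro member_le_sum) auto
  also have "\<dots> \<le> (\<Sum>t<n. \<Sum>k. (cmod (u t k))\<^sup>2)"
  proof -
    have "0 \<le> (\<Sum>j<k. \<Sum>s<m. (cmod (response u s j))\<^sup>2)"
      by (intro sum_nonneg) simp
    then show ?thesis
      using energy_bound[of u k] input_energy_le[of k] by linarith
  qed
  finally show "(cmod (state u k x))\<^sup>2 \<le> (\<Sum>t<n. \<Sum>k. (cmod (u t k))\<^sup>2)" .
qed

lemma square_summable_response:
  assumes "s < m"
  shows "square_summable (response u s)"
  unfolding square_summable_def
proof (rule summableI_nonneg_bounded)
  fix M
  have "(\<Sum>k<M. (cmod (response u s k))\<^sup>2) \<le> (\<Sum>k<M. \<Sum>s<m. (cmod (response u s k))\<^sup>2)"
    using assms by (intro sum_mono member_le_sum) auto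
  also note response_energy_le
  finally show "(\<Sum>k<M. (cmod (response u s k))\<^sup>2) \<le> (\<Sum>t<n. \<Sum>k. (cmod (u t k))\<^sup>2)" .
qed simp

lemma response_contractive:
  "(\<Sum>s<m. \<Sum>k. (cmod (response u s k))\<^sup>2) \<le> (\<Sum>t<n. \<Sum>k. (cmod (u t k))\<^sup>2)"
proof -
  have sm: "summable (\<lambda>k. (cmod (response u s k))\<^sup>2)" if "s < m" for s
    using square_summable_response[OF that] by (simp add: square_summable_def)
  have "(\<Sum>s<m. \<Sum>k. (cmod (response u s k))\<^sup>2) = (\<Sum>k. \<Sum>s<m. (cmod (response u s k))\<^sup>2)"
    using sm by (intro suminf_sum[symmetric]) auto
  also have "\<dots> \<le> (\<Sum>t<n. \<Sum>k. (cmod (u t k))\<^sup>2)"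
    using sm by (intro suminf_le_const summable_sum response_energy_le) auto
  finally show ?thesis .
qed

context
  fixes z :: complex
  assumes z: "cmod z < 1"
begin

lemma summable_state: "x < N \<Longrightarrow> summable (\<lambda>k. state u k x * z ^ k)"
  by (rule summable_bounded_power_series[OF state_bounded z])

lemma summable_input: "t < n \<Longrightarrow> summable (\<lambda>k. u t k * z ^ k)"
  using summable_square_summable_power_series[OF _ z] u by blast

lemma suminf_combination:
  "(\<Sum>k. ((\<Sum>y<N. a y * state u k y) + (\<Sum>t<n. b t * u t k)) * z ^ k)
    = (\<Sum>y<N. a y * (\<Sum>k. state u k y * z ^ k)) + (\<Sum>t<n. b t * (\<Sum>k. u t k * z ^ k))"
proof -
  have "(\<lambda>k. (\<Sum>y<N. a y * (state u k y * z ^ k)) + (\<Sum>t<n. b t * (u t k * z ^ k))) sums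
    ((\<Sum>y<N. a y * (\<Sum>k. state u k y * z ^ k)) + (\<Sum>t<n. b t * (\<Sum>k. u t k * z ^ k)))"
    by (intro sums_add sums_sum sums_mult summable_sums) (simp_all add: summable_state summable_input)
  then show ?thesis
    by (simp add: sums_iff distrib_right sum_distrib_right mult.assoc)
qed

text \<open>Shifting the recursion by one time step produces the factor z; the head term vanishes
  because the system starts at rest.\<close>

lemma state_series_eq:
  assumes "x < N"
  shows "(\<Sum>k. state u k x * z ^ k) = z * ((\<Sum>y<N. A x y * (\<Sum>k. state u k y * z ^ k))
    + (\<Sum>t<n. B x t * (\<Sum>k. u t k * z ^ k)))"
proof -
  have "(\<Sum>k. state u k x * z ^ k) = (\<Sum>k. state u (Suc k) x * z ^ Suc k)"
    using suminf_split_head[OF summable_state[OF assms]] by simp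
  also have "\<dots> = (\<Sum>k. z * (state u (Suc k) x * z ^ k))"
    by (simp add: mult_ac)
  also have "\<dots> = z * (\<Sum>k. state u (Suc k) x * z ^ k)"
  proof (rule suminf_mult)
    have "summable (\<lambda>k. state u (k + 1) x * z ^ k)"
      using state_bounded[OF assms] by (intro summable_bounded_power_series[OF _ z])
    then show "summable (\<lambda>k. state u (Suc k) x * z ^ k)" by simp
  qed
  finally show ?thesis
    by (simp add: suminf_combination)
qed

lemma response_series_eq:
  "(\<Sum>k. response u s k * z ^ k) = (\<Sum>y<N. C s y * (\<Sum>k. state u k y * z ^ k))
    + (\<Sum>t<n. D s t * (\<Sum>k. u t k * z ^ k))"
  unfolding response_def by (rule suminf_combination)

end
end

text \<open>Zero input shows that \<open>A\<close> is a contraction, so z A is a strict one and its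
  only fixed vector is 0.\<close>

lemma resolvent_unique:
  assumes z: "cmod z < 1" and X: "\<And>x. x < N \<Longrightarrow> X x = z * (\<Sum>y<N. A x y * X y)" and "x < N"
  shows "X x = 0"
proof -
  define E where "E = (\<Sum>x<N. (cmod (X x))\<^sup>2)"
  have "E = (\<Sum>x<N. (cmod z)\<^sup>2 * (cmod (\<Sum>y<N. A x y * X y))\<^sup>2)"
    unfolding E_def by (intro sum.cong refl, subst X) (auto simp: norm_mult power_mult_distrib)
  also have "\<dots> = (cmod z)\<^sup>2 * (\<Sum>x<N. (cmod (\<Sum>y<N. A x y * X y))\<^sup>2)"
    by (simp add: sum_distrib_left)
  also have "\<dots> \<le> (cmod z)\<^sup>2 * E"
    using contraction[of X "\<lambda>_. 0"] sum_nonneg[of "{..<m}" "\<lambda>s. (cmod (\<Sum>y<N. C s y * X y))\<^sup>2"]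
    by (intro mult_left_mono) (simp_all add: E_def)
  finally have "(1 - (cmod z)\<^sup>2) * E \<le> 0"
    by (simp add: algebra_simps)
  moreover have "(cmod z)\<^sup>2 < 1"
    using z by (simp add: power_less_one_iff abs_square_less_1)
  ultimately have "E \<le> 0"
    by (simp add: mult_le_0_iff)
  then have "E = 0"
    unfolding E_def by (meson antisym sum_nonneg zero_le_power2)
  then show ?thesis
    using assms(3) by (simp add: E_def sum_nonneg_eq_0_iff)
qed

definition impulse :: "nat \<Rightarrow> nat \<Rightarrow> nat \<Rightarrow> complex" where
  "impulse t t' k = (if k = 0 \<and> t' = t then 1 else 0)"

text \<open>This is the matrix z (I - z A)^(-1) B, obtained as the generating function of the state
  after a unit impulse instead of through a matrix inverse.\<close>

definition resolvent :: "complex \<Rightarrow> nat \<Rightarrow> nat \<Rightarrow> complex" where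
  "resolvent z x t = (\<Sum>k. state (impulse t) k x * z ^ k)"

text \<open>The standard transfer function D + z C (I - z A)^(-1) B.\<close>

definition transfer :: "complex \<Rightarrow> nat \<Rightarrow> nat \<Rightarrow> complex" where
  "transfer z s t = (\<Sum>y<N. C s y * resolvent z y t) + D s t"

lemma resolvent_eq:
  assumes "cmod z < 1" "x < N" "t < n"
  shows "resolvent z x t = z * ((\<Sum>y<N. A x y * resolvent z y t) + B x t)"
proof -
  have "square_summable (impulse t t')" for t'
    unfolding square_summable_def by (rule summable_finite[of "{0}"]) (auto simp: impulse_def)
  moreover have "(\<Sum>k. impulse t t' k * z ^ k) = (if t' = t then 1 else 0)" for t'
    by (subst suminf_finite[of "{0}"]) (auto simp: impulse_def)
  ultimately show ?thesis
    using state_series_eq[of "impulse t" z x] assms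
    by (simp add: resolvent_def if_distrib[of "\<lambda>x. _ * x"] cong: if_cong)
qed

text \<open>By uniqueness, the generating function of the state depends on the input only
  through the values of its generating functions at \<open>z\<close>.\<close>

lemma response_series_transfer:
  assumes u: "\<And>t. t < n \<Longrightarrow> square_summable (u t)" and z: "cmod z < 1"
  shows "(\<Sum>k. response u s k * z ^ k) = (\<Sum>t<n. transfer z s t * (\<Sum>k. u t k * z ^ k))"
proof -
  define U where "U t = (\<Sum>k. u t k * z ^ k)" for t
  define X where "X x = (\<Sum>k. state u k x * z ^ k)" for x
  define R where "R x = (\<Sum>t<n. resolvent z x t * U t)" for x
  have sumR: "(\<Sum>y<N. a y * R y) = (\<Sum>t<n. (\<Sum>y<N. a y * resolvent z y t) * U t)" for a
    unfolding R_def sum_distrib_left sum_distrib_right by (subst sum.swap) (simp add: mult_ac)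
  have R_eq: "R x = z * ((\<Sum>y<N. A x y * R y) + (\<Sum>t<n. B x t * U t))" if "x < N" for x
  proof -
    have "R x = (\<Sum>t<n. z * ((\<Sum>y<N. A x y * resolvent z y t) + B x t) * U t)"
      unfolding R_def by (intro sum.cong refl, subst resolvent_eq) (use z that in auto)
    also have "\<dots> = z * ((\<Sum>t<n. (\<Sum>y<N. A x y * resolvent z y t) * U t) + (\<Sum>t<n. B x t * U t))"
      by (simp only: sum_distrib_left sum.distrib[symmetric] mult.assoc distrib_right)
    finally show ?thesis by (simp add: sumR)
  qed
  have X_eq: "X x = z * ((\<Sum>y<N. A x y * X y) + (\<Sum>t<n. B x t * U t))" if "x < N" for x
    unfolding X_def U_def by (rule state_series_eq[OF _ z that]) (rule u)
  have "X x - R x = 0" if "x < N" for x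
  proof (rule resolvent_unique[OF z _ that])
    fix x assume "x < N"
    then show "X x - R x = z * (\<Sum>y<N. A x y * (X y - R y))"
      using X_eq[of x] R_eq[of x] by (simp add: right_diff_distrib sum_subtractf distrib_left)
  qed
  then have "(\<Sum>y<N. C s y * X y) = (\<Sum>y<N. C s y * R y)"
    by simp
  then show ?thesis
    using response_series_eq[where u = u and s = s, OF _ z] u
    by (simp add: X_def[symmetric] U_def[symmetric] sumR transfer_def distrib_right sum.distrib)
qed

text \<open>The first equation says that the row vector a equals row s of C (I - z A)^(-1);
  inserting this into the second one gives the transfer function.\<close>

lemma transfer_interpolates:
  assumes z: "cmod z < 1" and "t < n"
    and a: "\<And>y. y < N \<Longrightarrow> a y = C s y + z * (\<Sum>x<N. a x * A x y)"
    and W: "W = D s t + z * (\<Sum>x<N. a x * B x t)"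
  shows "transfer z s t = W"
proof -
  let ?X = "\<lambda>y. resolvent z y t"
  have "(\<Sum>y<N. C s y * ?X y) = (\<Sum>y<N. (a y - z * (\<Sum>x<N. a x * A x y)) * ?X y)"
    by (intro sum.cong refl, subst a) auto
  also have "\<dots> = (\<Sum>y<N. a y * ?X y) - z * (\<Sum>y<N. (\<Sum>x<N. a x * A x y) * ?X y)"
    by (simp add: left_diff_distrib sum_subtractf mult.assoc flip: sum_distrib_left)
  also have "(\<Sum>y<N. (\<Sum>x<N. a x * A x y) * ?X y) = (\<Sum>x<N. a x * (\<Sum>y<N. A x y * ?X y))"
    unfolding sum_distrib_left sum_distrib_right by (subst sum.swap) (simp add: mult_ac)
  also have "(\<Sum>y<N. a y * ?X y) = (\<Sum>x<N. a x * (z * ((\<Sum>y<N. A x y * ?X y) + B x t)))"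
    using z assms(2) by (intro sum.cong refl, subst resolvent_eq) auto
  also have "\<dots> = z * (\<Sum>x<N. a x * (\<Sum>y<N. A x y * ?X y)) + z * (\<Sum>x<N. a x * B x t)"
    by (simp add: distrib_left sum.distrib sum_distrib_left mult_ac)
  finally show ?thesis
    using W by (simp add: transfer_def)
qed

end

section \<open>Weighted Hardy spaces\<close>

lemma norm_add_power2_le:
  fixes x y :: complex
  shows "(cmod (x + y))\<^sup>2 \<le> 2 * (cmod x)\<^sup>2 + 2 * (cmod y)\<^sup>2"
proof -
  have "(cmod (x + y))\<^sup>2 + (cmod (x - y))\<^sup>2 = 2 * (cmod x)\<^sup>2 + 2 * (cmod y)\<^sup>2"
    by (simp only: cmod_power2) (simp add: power2_eq_square algebra_simps)
  then show ?thesis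
    using zero_le_power2[of "cmod (x - y)"] by linarith
qed

lemma square_summable_zero: "square_summable (\<lambda>k. 0)"
  by (simp add: square_summable_def)

lemma square_summable_add:
  assumes "square_summable a" "square_summable b"
  shows "square_summable (\<lambda>k. a k + b k)"
  unfolding square_summable_def
proof (rule summable_comparison_test')
  show "summable (\<lambda>k. 2 * (cmod (a k))\<^sup>2 + 2 * (cmod (b k))\<^sup>2)"
    using assms unfolding square_summable_def by (intro summable_add summable_mult)
qed (simp add: norm_add_power2_le)

lemma square_summable_scale:
  assumes "square_summable a"
  shows "square_summable (\<lambda>k. c * a k)"
  using assms unfolding square_summable_def by (simp add: norm_mult power_mult_distrib summable_mult)

lemma square_summable_diff:
  assumes "square_summable a" "square_summable b"
  shows "square_summable (\<lambda>k. a k - b k)"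
  using square_summable_add[OF assms(1) square_summable_scale[OF assms(2), of "-1"]] by simp

lemma square_summable_mult_cnj:
  assumes "square_summable a" "square_summable b"
  shows "summable (\<lambda>k. a k * cnj (b k))"
proof (rule summable_comparison_test')
  show "summable (\<lambda>k. (cmod (a k))\<^sup>2 + (cmod (b k))\<^sup>2)"
    using assms unfolding square_summable_def by (intro summable_add)
  show "norm (a k * cnj (b k)) \<le> (cmod (a k))\<^sup>2 + (cmod (b k))\<^sup>2" for k
    unfolding norm_mult complex_mod_cnj
    using sum_squares_bound[of "cmod (a k)" "cmod (b k)"] mult_nonneg_nonneg[OF norm_ge_zero norm_ge_zero, of "a k" "b k"]
    by linarith
qed

text \<open>The Cauchy bound passes to the coordinatewise limit in finite partial sums first, and
  only then to the whole series.\<close>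

lemma square_summable_complete:
  assumes A: "\<And>n. square_summable (A n)"
    and Cauchy: "\<And>\<epsilon>. 0 < \<epsilon> \<Longrightarrow> \<exists>N. \<forall>m\<ge>N. \<forall>n\<ge>N. sqrt (\<Sum>k. (cmod (A m k - A n k))\<^sup>2) < \<epsilon>"
  shows "\<exists>a. square_summable a \<and> (\<lambda>n :: nat. sqrt (\<Sum>k. (cmod (A n k - a k))\<^sup>2)) \<longlonglongrightarrow> 0"
proof -
  have "Cauchy (\<lambda>n. A n k)" for k
  proof (rule metric_CauchyI)
    fix \<epsilon> :: real assume "0 < \<epsilon>"
    from Cauchy[OF this] obtain N where N: "\<forall>m\<ge>N. \<forall>n\<ge>N. sqrt (\<Sum>k. (cmod (A m k - A n k))\<^sup>2) < \<epsilon>"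
      by blast
    have "dist (A m k) (A n k) < \<epsilon>" if "m \<ge> N" "n \<ge> N" for m n
    proof -
      have "dist (A m k) (A n k) \<le> sqrt (\<Sum>k. (cmod (A m k - A n k))\<^sup>2)"
        unfolding dist_norm by (rule square_summable_bounded[OF square_summable_diff[OF A A]])
      also have "\<dots> < \<epsilon>"
        using N that by blast
      finally show ?thesis .
    qed
    then show "\<exists>M. \<forall>m\<ge>M. \<forall>n\<ge>M. dist (A m k) (A n k) < \<epsilon>"
      by blast
  qed
  then have a: "(\<lambda>n. A n k) \<longlonglongrightarrow> lim (\<lambda>n. A n k)" for k
    unfolding Cauchy_convergent_iff convergent_LIMSEQ_iff by blast
  define a where "a k = lim (\<lambda>n. A n k)" for k
  note a = a[folded a_def]
  have close: "\<exists>N. \<forall>n\<ge>N. square_summable (\<lambda>k. A n k - a k) \<and> sqrt (\<Sum>k. (cmod (A n k - a k))\<^sup>2) \<le> \<epsilon>"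
    if \<epsilon>: "0 < \<epsilon>" for \<epsilon>
  proof -
    from Cauchy[OF \<epsilon>] obtain N where N: "\<forall>m\<ge>N. \<forall>n\<ge>N. sqrt (\<Sum>k. (cmod (A m k - A n k))\<^sup>2) < \<epsilon>"
      by blast
    have "square_summable (\<lambda>k. A n k - a k) \<and> sqrt (\<Sum>k. (cmod (A n k - a k))\<^sup>2) \<le> \<epsilon>" if n: "n \<ge> N" for n
    proof -
      have part: "(\<Sum>k<M. (cmod (A n k - a k))\<^sup>2) \<le> \<epsilon>\<^sup>2" for M
      proof (rule LIMSEQ_le_const2)
        show "(\<lambda>m. \<Sum>k<M. (cmod (A n k - A m k))\<^sup>2) \<longlonglongrightarrow> (\<Sum>k<M. (cmod (A n k - a k))\<^sup>2)"
          by (intro tendsto_intros a)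
        have "(\<Sum>k<M. (cmod (A n k - A m k))\<^sup>2) \<le> \<epsilon>\<^sup>2" if m: "m \<ge> N" for m
        proof -
          have sm: "summable (\<lambda>k. (cmod (A n k - A m k))\<^sup>2)"
            using square_summable_diff[OF A A] by (simp add: square_summable_def)
          have "(\<Sum>k<M. (cmod (A n k - A m k))\<^sup>2) \<le> (\<Sum>k. (cmod (A n k - A m k))\<^sup>2)"
            by (rule sum_le_suminf[OF sm]) auto
          also have "\<dots> = (sqrt (\<Sum>k. (cmod (A n k - A m k))\<^sup>2))\<^sup>2"
            by (simp add: suminf_nonneg[OF sm])
          also have "\<dots> \<le> \<epsilon>\<^sup>2"
            using N n m by (intro power_mono) (auto intro: less_imp_le simp: suminf_nonneg[OF sm])
          finally show ?thesis .
        qed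
        then show "\<exists>N. \<forall>m\<ge>N. (\<Sum>k<M. (cmod (A n k - A m k))\<^sup>2) \<le> \<epsilon>\<^sup>2"
          by blast
      qed
      have sm: "summable (\<lambda>k. (cmod (A n k - a k))\<^sup>2)"
        by (rule summableI_nonneg_bounded[OF _ part]) simp
      moreover have "(\<Sum>k. (cmod (A n k - a k))\<^sup>2) \<le> \<epsilon>\<^sup>2"
        by (rule suminf_le_const[OF sm part])
      ultimately show ?thesis
        using \<epsilon> by (auto simp: square_summable_def intro: real_le_lsqrt suminf_nonneg)
    qed
    then show ?thesis by blast
  qed
  obtain N where "square_summable (\<lambda>k. A N k - a k)"
    using close[of 1] by auto
  from square_summable_diff[OF A[of N] this] have "square_summable a"
    by simp
  moreover have "(\<lambda>n. sqrt (\<Sum>k. (cmod (A n k - a k))\<^sup>2)) \<longlonglongrightarrow> 0"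
  proof (rule LIMSEQ_I)
    fix r :: real assume "0 < r"
    then obtain N where "\<And>n. n \<ge> N \<Longrightarrow> square_summable (\<lambda>k. A n k - a k) \<and> sqrt (\<Sum>k. (cmod (A n k - a k))\<^sup>2) \<le> r / 2"
      using close[of "r / 2"] by auto
    moreover from this have "0 \<le> sqrt (\<Sum>k. (cmod (A n k - a k))\<^sup>2)" if "n \<ge> N" for n
      using that by (auto simp: square_summable_def intro: suminf_nonneg)
    ultimately show "\<exists>N. \<forall>n\<ge>N. norm (sqrt (\<Sum>k. (cmod (A n k - a k))\<^sup>2) - 0) < r"
      using \<open>0 < r\<close> by (intro exI[of _ N]) fastforce
  qed
  ultimately show ?thesis by blast
qed

text \<open>The space of the functions \<open>G \<cdot> (f \<circ> q)\<close> with \<open>f\<close> in the Hardy space of the disc.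
  As \<open>q\<close> maps onto the disc, \<open>f\<close> is determined by \<open>G \<cdot> (f \<circ> q)\<close>.\<close>

locale weighted_hardy =
  fixes \<Omega> :: "'a set" and G q :: "'a \<Rightarrow> complex"
  assumes q_image: "q ` \<Omega> = ball 0 1"
    and G_nonzero: "x \<in> \<Omega> \<Longrightarrow> G x \<noteq> 0"
begin

definition emb :: "(nat \<Rightarrow> complex) \<Rightarrow> 'a \<Rightarrow> complex" where
  "emb a x = (if x \<in> \<Omega> then G x * (\<Sum>k. a k * q x ^ k) else 0)"

definition hardy_space :: "('a \<Rightarrow> complex) set" where
  "hardy_space = emb ` {a. square_summable a}"

text \<open>The inner product takes functions as arguments and has to recover their power series
  coefficients; \<open>emb_inj\<close> makes the inverse faithful.\<close>

definition coef :: "('a \<Rightarrow> complex) \<Rightarrow> nat \<Rightarrow> complex" where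
  "coef = inv_into {a. square_summable a} emb"

definition inner_prod :: "('a \<Rightarrow> complex) \<Rightarrow> ('a \<Rightarrow> complex) \<Rightarrow> complex" where
  "inner_prod f g = (\<Sum>k. coef f k * cnj (coef g k))"

lemma q_less: "x \<in> \<Omega> \<Longrightarrow> cmod (q x) < 1"
  using q_image by auto

lemma summable_q: "square_summable a \<Longrightarrow> x \<in> \<Omega> \<Longrightarrow> summable (\<lambda>k. a k * q x ^ k)"
  using summable_square_summable_power_series q_less by blast

lemma emb_inj:
  assumes "square_summable a" "square_summable b" "emb a = emb b"
  shows "a = b"
proof (rule ccontr)
  assume "a \<noteq> b"
  then obtain m where m: "a m - b m \<noteq> 0"
    by auto
  have "(\<lambda>k. (a k - b k) * (z - 0) ^ k) sums 0" if z: "norm (z - 0) < 1" for z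
  proof -
    obtain x where x: "x \<in> \<Omega>" "q x = z"
      using z q_image by (metis diff_zero imageE mem_ball_0)
    have "(\<Sum>k. a k * z ^ k) = (\<Sum>k. b k * z ^ k)"
      using fun_cong[OF assms(3), of x] x G_nonzero[of x] by (simp add: emb_def)
    moreover have "summable (\<lambda>k. a k * z ^ k)" "summable (\<lambda>k. b k * z ^ k)"
      using summable_q assms(1,2) x by blast+
    ultimately show ?thesis
      using sums_diff[of "\<lambda>k. a k * z ^ k" _ "\<lambda>k. b k * z ^ k"] by (fastforce simp: sums_iff left_diff_distrib)
  qed
  note sums = this
  \<comment> \<open>The theorem on isolated zeros used next concerns a nonzero coefficient of
    positive index; index 0 is settled by evaluating at the centre.\<close>
  have "m > 0"
    using sums[of 0] m by (cases "m = 0") auto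
  show False
  proof (rule powser_0_nonzero[of 1 0 "\<lambda>k. a k - b k" "\<lambda>_. 0" m])
    show "(\<lambda>k. (a k - b k) * (z - 0) ^ k) sums 0" if "norm (z - 0) < 1" for z
      using that by (rule sums)
    show False if "0 < s" "\<And>z::complex. z \<in> cball 0 s - {0} \<Longrightarrow> (0::complex) \<noteq> 0" for s
      using that(1) that(2)[of "of_real s"] by simp
  qed (use m \<open>m > 0\<close> in auto)
qed

lemma coef_emb: "square_summable a \<Longrightarrow> coef (emb a) = a"
  unfolding coef_def by (rule inv_into_f_f) (auto intro!: inj_onI emb_inj)

lemma emb_mem: "square_summable a \<Longrightarrow> emb a \<in> hardy_space"
  by (auto simp: hardy_space_def)

lemma mem_spaceE:
  assumes "f \<in> hardy_space"
  obtains a where "square_summable a" "f = emb a"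
  using assms by (auto simp: hardy_space_def)

lemma inner_prod_emb:
  "square_summable a \<Longrightarrow> square_summable b \<Longrightarrow> inner_prod (emb a) (emb b) = (\<Sum>k. a k * cnj (b k))"
  by (simp add: inner_prod_def coef_emb)

lemma emb_zero: "emb (\<lambda>k. 0) = (\<lambda>x. 0)"
  by (auto simp: emb_def)

lemma emb_add:
  assumes "square_summable a" "square_summable b"
  shows "emb (\<lambda>k. a k + b k) = (\<lambda>x. emb a x + emb b x)"
  using summable_q assms by (auto simp: emb_def distrib_right distrib_left suminf_add[symmetric])

lemma emb_scale:
  assumes "square_summable a"
  shows "emb (\<lambda>k. c * a k) = (\<lambda>x. c * emb a x)"
  using summable_q assms by (auto simp: emb_def mult.assoc suminf_mult)

lemma emb_diff:
  assumes "square_summable a" "square_summable b"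
  shows "emb (\<lambda>k. a k - b k) = (\<lambda>x. emb a x - emb b x)"
  using emb_add[OF assms(1) square_summable_scale[OF assms(2), of "-1"]] emb_scale[OF assms(2), of "-1"]
  by simp

lemma inner_prod_self:
  assumes "square_summable a"
  shows "inner_prod (emb a) (emb a) = of_real (\<Sum>k. (cmod (a k))\<^sup>2)"
proof -
  have "inner_prod (emb a) (emb a) = (\<Sum>k. of_real ((cmod (a k))\<^sup>2))"
    by (simp only: inner_prod_emb assms complex_norm_square)
  also have "\<dots> = of_real (\<Sum>k. (cmod (a k))\<^sup>2)"
    using assms by (intro suminf_of_real[symmetric]) (simp add: square_summable_def)
  finally show ?thesis .
qed

lemma ip_norm_emb: "square_summable a \<Longrightarrow> ip_norm inner_prod (emb a) = sqrt (\<Sum>k. (cmod (a k))\<^sup>2)"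
  by (simp add: ip_norm_def inner_prod_self)

sublocale hilbert_function_space \<Omega> hardy_space inner_prod
proof
  fix f g h and c :: complex
  show "f x = 0" if "f \<in> hardy_space" "x \<notin> \<Omega>" for x
    using that by (auto simp: hardy_space_def emb_def)
  show "(\<lambda>x. 0) \<in> hardy_space"
    using emb_mem[OF square_summable_zero] by (simp add: emb_zero)
  show "(\<lambda>x. f x + g x) \<in> hardy_space" if "f \<in> hardy_space" "g \<in> hardy_space"
    using that by (elim mem_spaceE) (auto simp flip: emb_add intro: emb_mem square_summable_add)
  show "(\<lambda>x. c * f x) \<in> hardy_space" if "f \<in> hardy_space"
    using that by (elim mem_spaceE) (auto simp flip: emb_scale intro: emb_mem square_summable_scale)
  show "inner_prod (\<lambda>x. f x + g x) h = inner_prod f h + inner_prod g h"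
    if "f \<in> hardy_space" "g \<in> hardy_space" "h \<in> hardy_space"
    using that by (elim mem_spaceE) (simp add: inner_prod_emb square_summable_add square_summable_mult_cnj
        distrib_right suminf_add[symmetric] flip: emb_add)
  show "inner_prod (\<lambda>x. c * f x) g = c * inner_prod f g" if "f \<in> hardy_space" "g \<in> hardy_space"
    using that by (elim mem_spaceE) (simp add: inner_prod_emb square_summable_scale square_summable_mult_cnj
        mult.assoc suminf_mult flip: emb_scale)
  show "inner_prod g f = cnj (inner_prod f g)" if fg: "f \<in> hardy_space" "g \<in> hardy_space"
  proof -
    obtain a b where ab: "square_summable a" "f = emb a" "square_summable b" "g = emb b"
      using fg by (auto simp: hardy_space_def)
    have "(\<lambda>k. cnj (a k * cnj (b k))) sums cnj (\<Sum>k. a k * cnj (b k))"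
      unfolding sums_cnj by (intro summable_sums square_summable_mult_cnj ab)
    then show ?thesis
      using ab by (simp add: inner_prod_emb sums_iff mult.commute)
  qed
  show "0 < Re (inner_prod f f)" if f: "f \<in> hardy_space" "f \<noteq> (\<lambda>x. 0)"
  proof -
    obtain a where a: "square_summable a" "f = emb a"
      using f by (auto simp: hardy_space_def)
    have "a \<noteq> (\<lambda>k. 0)"
      using f(2) a(2) emb_zero by blast
    then obtain k where "a k \<noteq> 0"
      by auto
    then have "0 < (\<Sum>k. (cmod (a k))\<^sup>2)"
      using a(1) by (intro suminf_pos2[where i = k]) (auto simp: square_summable_def)
    then show ?thesis
      using a by (simp add: inner_prod_self)
  qed
next
  fix F :: "nat \<Rightarrow> 'a \<Rightarrow> complex"
  assume F: "\<And>n. F n \<in> hardy_space"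
    and Cauchy: "\<forall>\<epsilon>>0. \<exists>N. \<forall>m\<ge>N. \<forall>n\<ge>N. ip_norm inner_prod (\<lambda>x. F m x - F n x) < \<epsilon>"
  have "\<forall>n. \<exists>a. square_summable a \<and> F n = emb a"
    using F by (auto simp: hardy_space_def)
  then obtain A where A: "\<And>n. square_summable (A n)" "\<And>n. F n = emb (A n)"
    by metis
  have diff: "ip_norm inner_prod (\<lambda>x. F m x - emb b x) = sqrt (\<Sum>k. (cmod (A m k - b k))\<^sup>2)"
    if "square_summable b" for m b
    using ip_norm_emb[OF square_summable_diff[OF A(1) that], of m]
    by (simp add: A(2) emb_diff[OF A(1) that])
  have "\<exists>N. \<forall>m\<ge>N. \<forall>n\<ge>N. sqrt (\<Sum>k. (cmod (A m k - A n k))\<^sup>2) < \<epsilon>" if "0 < \<epsilon>" for \<epsilon>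
    using Cauchy that diff[OF A(1)] unfolding A(2)[symmetric] by simp
  from square_summable_complete[OF A(1) this] obtain a where
    a: "square_summable a" "(\<lambda>n. sqrt (\<Sum>k. (cmod (A n k - a k))\<^sup>2)) \<longlonglongrightarrow> 0"
    by blast
  then show "\<exists>f\<in>hardy_space. (\<lambda>n. ip_norm inner_prod (\<lambda>x. F n x - f x)) \<longlonglongrightarrow> 0"
    by (intro bexI[of _ "emb a"] emb_mem) (simp_all add: diff)
qed

end

text \<open>A lurking isometry argument: the Gram vectors \<open>A\<close> of the Pick data define an isometry
  \<open>(z\<^sub>p A\<^sub>p, e\<^sub>p) \<mapsto> (A\<^sub>p, W\<^sub>p)\<close>, where \<open>e\<^sub>p\<close> is the unit vector with index \<open>\<sigma> p\<close>, and any contraction extending it is the system matrix of a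
  contractive linear system with transfer function interpolating the data.\<close>

lemma interpolating_system_exists:
  fixes z :: "nat \<Rightarrow> complex" and A W :: "nat \<Rightarrow> nat \<Rightarrow> complex" and \<sigma> :: "nat \<Rightarrow> nat"
  assumes z: "\<And>p. p < N \<Longrightarrow> cmod (z p) < 1" and \<sigma>: "\<And>p. p < N \<Longrightarrow> \<sigma> p < m"
    and gram: "\<And>p r. p < N \<Longrightarrow> r < N \<Longrightarrow> (1 - z p * cnj (z r)) * (\<Sum>l<N. A p l * cnj (A r l))
      = (if \<sigma> p = \<sigma> r then 1 else 0) - (\<Sum>t<n. W p t * cnj (W r t))"
  shows "\<exists>A' B C D. contractive_system N m n A' B C D \<and>
    (\<forall>p<N. \<forall>t<n. contractive_system.transfer N n A' B C D (z p) (\<sigma> p) t = W p t)"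
proof -
  define X Y where "X = {..<N} <+> {..<m}" and "Y = {..<N} <+> {..<n}"
  \<comment> \<open>Left summands are states and right summands are signals. Rows are multiplied by
    \<open>S\<close> from the right, so on columns \<open>S\<close> sends (state, input) to (next
    state, output).\<close>
  define u where "u p = case_sum (\<lambda>l. z p * A p l) (\<lambda>s. if s = \<sigma> p then 1 else 0)" for p
  define v where "v p = case_sum (A p) (W p)" for p
  have sumX: "(\<Sum>x\<in>X. f x) = (\<Sum>l<N. f (Inl l)) + (\<Sum>s<m. f (Inr s))" for f :: "nat + nat \<Rightarrow> complex"
    by (simp add: X_def sum.Plus)
  have sumX': "(\<Sum>x\<in>X. f x) = (\<Sum>l<N. f (Inl l)) + (\<Sum>s<m. f (Inr s))" for f :: "nat + nat \<Rightarrow> real"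
    by (simp add: X_def sum.Plus)
  have sumY: "(\<Sum>x\<in>Y. f x) = (\<Sum>l<N. f (Inl l)) + (\<Sum>t<n. f (Inr t))" for f :: "nat + nat \<Rightarrow> complex"
    by (simp add: Y_def sum.Plus)
  have sumY': "(\<Sum>x\<in>Y. f x) = (\<Sum>l<N. f (Inl l)) + (\<Sum>t<n. f (Inr t))" for f :: "nat + nat \<Rightarrow> real"
    by (simp add: Y_def sum.Plus)
  have delta: "(\<Sum>s<m. (if s = \<sigma> p then 1 else 0) * f s) = f (\<sigma> p)" if "p < N" for p and f :: "nat \<Rightarrow> complex"
    using \<sigma>[OF that] by (simp add: if_distrib[of "\<lambda>x. x * _"] cong: if_cong)
  have fin: "finite X" "finite Y"
    by (simp_all add: X_def Y_def)
  have Y: "y < N \<Longrightarrow> Inl y \<in> Y" "t < n \<Longrightarrow> Inr t \<in> Y" for y t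
    by (auto simp: Y_def)
  have "(\<Sum>x\<in>X. u p x * cnj (u r x)) = (\<Sum>y\<in>Y. v p y * cnj (v r y))" if "p < N" "r < N" for p r
  proof -
    have "(\<Sum>x\<in>X. u p x * cnj (u r x))
      = z p * cnj (z r) * (\<Sum>l<N. A p l * cnj (A r l)) + (if \<sigma> p = \<sigma> r then 1 else 0)"
      using delta[OF that(1), of "\<lambda>s. cnj (if s = \<sigma> r then 1 else 0)"]
      by (simp add: sumX u_def sum_distrib_left mult_ac)
    also have "\<dots> = (\<Sum>l<N. A p l * cnj (A r l)) + (\<Sum>t<n. W p t * cnj (W r t))"
      using gram[OF that] by (simp add: algebra_simps)
    finally show ?thesis
      by (simp add: sumY v_def)
  qed
  then have gram_uv: "\<forall>p\<in>{..<N}. \<forall>r\<in>{..<N}. (\<Sum>x\<in>X. u p x * cnj (u r x)) = (\<Sum>y\<in>Y. v p y * cnj (v r y))"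
    by blast
  obtain S where "\<forall>p\<in>{..<N}. \<forall>y\<in>Y. (\<Sum>x\<in>X. u p x * S x y) = v p y"
    and contr: "\<forall>w. (\<Sum>x\<in>X. (cmod (\<Sum>y\<in>Y. S x y * w y))\<^sup>2) \<le> (\<Sum>y\<in>Y. (cmod (w y))\<^sup>2)"
    using partial_isometry_exists[OF finite_lessThan fin gram_uv] by (elim exE conjE)
  then have S: "\<And>p y. p < N \<Longrightarrow> y \<in> Y \<Longrightarrow> (\<Sum>x\<in>X. u p x * S x y) = v p y"
    by simp
  define A' B C D where "A' x y = S (Inl x) (Inl y)" and "B x t = S (Inl x) (Inr t)"
    and "C s y = S (Inr s) (Inl y)" and "D s t = S (Inr s) (Inr t)" for x y s t
  interpret sys: contractive_system N m n A' B C D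
  proof
    fix w e
    show "(\<Sum>x<N. (cmod ((\<Sum>y<N. A' x y * w y) + (\<Sum>t<n. B x t * e t)))\<^sup>2)
      + (\<Sum>s<m. (cmod ((\<Sum>y<N. C s y * w y) + (\<Sum>t<n. D s t * e t)))\<^sup>2)
      \<le> (\<Sum>y<N. (cmod (w y))\<^sup>2) + (\<Sum>t<n. (cmod (e t))\<^sup>2)"
      using contr[THEN spec, of "case_sum w e"] by (simp add: sumX' sumY sumY' A'_def B_def C_def D_def)
  qed
  \<comment> \<open>The interpolation equations for \<open>S\<close>, read in its state and input
    columns, are exactly the two hypotheses of \<open>transfer_interpolates\<close>.\<close>
  have row: "v p y = z p * (\<Sum>x<N. A p x * S (Inl x) y) + S (Inr (\<sigma> p)) y" if "p < N" "y \<in> Y" for p y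
    using S[OF that] delta[OF that(1), of "\<lambda>s. S (Inr s) y"]
    by (simp add: sumX u_def sum_distrib_left mult.assoc)
  have "sys.transfer (z p) (\<sigma> p) t = W p t" if "p < N" "t < n" for p t
  proof (rule sys.transfer_interpolates[OF z[OF that(1)] that(2), where a = "A p"])
    show "A p y = C (\<sigma> p) y + z p * (\<Sum>x<N. A p x * A' x y)" if "y < N" for y
      using row[OF \<open>p < N\<close>, of "Inl y"] that by (simp add: v_def C_def A'_def Y)
    show "W p t = D (\<sigma> p) t + z p * (\<Sum>x<N. A p x * B x t)"
      using row[OF that(1), of "Inr t"] that by (simp add: v_def D_def B_def Y)
  qed
  with sys.contractive_system_axioms show ?thesis by blast
qed

section \<open>Matrix-valued Pick interpolation in a weighted Hardy space\<close>

context weighted_hardy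
begin

text \<open>On coefficient sequences, multiplication by the transfer function is the input-output
  map of the system, so the norm bound is \<open>response_contractive\<close>.\<close>

lemma transfer_contractive_multiplier:
  assumes "contractive_system N m n A B C D"
  shows "contractive_multiplier \<Omega> hardy_space inner_prod m n
    (\<lambda>x. Matrix.mat m n (\<lambda>(s, t). contractive_system.transfer N n A B C D (q x) s t))"
proof -
  interpret sys: contractive_system N m n A B C D by (rule assms)
  let ?\<Phi> = "\<lambda>x. Matrix.mat m n (\<lambda>(s, t). sys.transfer (q x) s t)"
  show ?thesis
    unfolding contractive_multiplier_def
  proof (intro conjI ballI allI impI)
    fix F :: "nat \<Rightarrow> 'a \<Rightarrow> complex" assume "\<forall>j<n. F j \<in> hardy_space"
    then have "\<forall>j. \<exists>a. j < n \<longrightarrow> square_summable a \<and> F j = emb a"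
      by (auto simp: hardy_space_def)
    then obtain u where u: "\<And>j. j < n \<Longrightarrow> square_summable (u j)" "\<And>j. j < n \<Longrightarrow> F j = emb (u j)"
      by metis
    have eq: "mult_op n ?\<Phi> F s = emb (sys.response u s)" if s: "s < m" for s
    proof
      fix x
      show "mult_op n ?\<Phi> F s x = emb (sys.response u s) x"
      proof (cases "x \<in> \<Omega>")
        case True
        then have "emb (sys.response u s) x = G x * (\<Sum>t<n. sys.transfer (q x) s t * (\<Sum>k. u t k * q x ^ k))"
          using sys.response_series_transfer[OF u(1) q_less[OF True]] by (simp add: emb_def)
        then show ?thesis
          using True s by (simp add: mult_op_def u(2) emb_def sum_distrib_left mult_ac)
      qed (simp add: mult_op_def u(2) emb_def)
    qed
    have resp: "square_summable (sys.response u s)" if "s < m" for s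
      using u(1) that by (rule sys.square_summable_response)
    show "mult_op n ?\<Phi> F s \<in> hardy_space" if "s < m" for s
      using that by (simp add: eq emb_mem resp)
    have norm: "(ip_norm inner_prod (emb a))\<^sup>2 = (\<Sum>k. (cmod (a k))\<^sup>2)" if "square_summable a" for a
      using that by (simp add: ip_norm_emb suminf_nonneg square_summable_def)
    show "tuple_norm inner_prod m (mult_op n ?\<Phi> F) \<le> tuple_norm inner_prod n F"
      using sys.response_contractive[of u] u by (simp add: tuple_norm_def eq norm resp)
  qed simp
qed

lemma cnp_kernel:
  assumes K: "\<And>x y. x \<in> \<Omega> \<Longrightarrow> y \<in> \<Omega> \<Longrightarrow> K x y = G x * cnj (G y) / (1 - q x * cnj (q y))"
  shows "cnp_kernel \<Omega> K"
proof -
  have q_prod: "cmod (q x * cnj (q y)) < 1" if "x \<in> \<Omega>" "y \<in> \<Omega>" for x y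
    using mult_strict_mono'[OF q_less[OF that(1)] q_less[OF that(2)]] by (simp add: norm_mult)
  have ker: "square_summable (\<lambda>k. cnj (G y) * cnj (q y) ^ k)" if "y \<in> \<Omega>" for y
  proof (rule square_summable_scale)
    have "(cmod (q y))\<^sup>2 < 1"
      using q_less[OF that] by (simp add: abs_square_less_1)
    then have "summable (\<lambda>k. ((cmod (q y))\<^sup>2) ^ k)"
      by (intro summable_geometric) simp
    then show "square_summable (\<lambda>k. cnj (q y) ^ k)"
      by (simp add: square_summable_def norm_power mult.commute flip: power_mult)
  qed
  have kernel: "kernel_fun \<Omega> K y = emb (\<lambda>k. cnj (G y) * cnj (q y) ^ k)" if y: "y \<in> \<Omega>" for y
  proof
    fix x
    show "kernel_fun \<Omega> K y x = emb (\<lambda>k. cnj (G y) * cnj (q y) ^ k) x"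
    proof (cases "x \<in> \<Omega>")
      case True
      have "(\<lambda>k. cnj (G y) * (q x * cnj (q y)) ^ k) sums (cnj (G y) * (1 / (1 - q x * cnj (q y))))"
        by (intro sums_mult geometric_sums q_prod True y)
      then have "(\<Sum>k. cnj (G y) * cnj (q y) ^ k * q x ^ k) = cnj (G y) / (1 - q x * cnj (q y))"
        by (simp add: sums_iff power_mult_distrib mult_ac)
      then show ?thesis
        using True y by (simp add: kernel_fun_def emb_def K)
    qed (simp add: kernel_fun_def emb_def)
  qed
  interpret rkhs \<Omega> K hardy_space inner_prod
  proof
    show "kernel_fun \<Omega> K y \<in> hardy_space" if "y \<in> \<Omega>" for y
      using that by (simp add: kernel emb_mem ker)
    show "inner_prod f (kernel_fun \<Omega> K y) = f y" if f: "f \<in> hardy_space" and y: "y \<in> \<Omega>" for f y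
    proof -
      obtain a where a: "square_summable a" "f = emb a"
        using f by (auto simp: hardy_space_def)
      have "inner_prod f (kernel_fun \<Omega> K y) = (\<Sum>k. G y * (a k * q y ^ k))"
        using a ker[OF y] by (simp add: kernel[OF y] inner_prod_emb mult_ac)
      also have "\<dots> = f y"
        using y summable_q[OF a(1) y] by (simp add: a(2) emb_def suminf_mult)
      finally show ?thesis .
    qed
  qed
  have "cnp_space \<Omega> K hardy_space inner_prod"
    unfolding cnp_space_def
  proof (intro allI impI, elim conjE)
    fix m n k and x :: "nat \<Rightarrow> 'a" and W :: "nat \<Rightarrow> complex mat"
    assume m: "1 \<le> m" and x: "x ` {..<k} \<subseteq> \<Omega>" and W: "\<forall>i<k. W i \<in> carrier_mat m n"
      and psd: "psd_mat (pick_mat K m k x W)"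
    define N where "N = k * m"
    \<comment> \<open>Every row of every prescribed matrix becomes one interpolation condition p,
      with point number \<open>i p\<close> and row number \<open>\<sigma> p\<close>.\<close>
    define i \<sigma> where "i p = p div m" and "\<sigma> p = p mod m" for p
    have i: "i p < k" and \<sigma>: "\<sigma> p < m" if "p < N" for p
      using that m by (auto simp: i_def \<sigma>_def N_def less_mult_imp_div_less)
    have x\<Omega>: "x (i p) \<in> \<Omega>" if "p < N" for p
      using x i[OF that] by auto
    define P where "P p r = K (x (i p)) (x (i r)) * ((if \<sigma> p = \<sigma> r then 1 else 0)
      - (\<Sum>t<n. W (i p) $$ (\<sigma> p, t) * cnj (W (i r) $$ (\<sigma> r, t))))" for p r
    have "pick_mat K m k x W = Matrix.mat N N (\<lambda>(p, r). P p r)"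
      unfolding P_def i_def \<sigma>_def N_def using W by (intro pick_mat_eq) auto
    then have "psd_on {..<N} P"
      using psd by (simp add: psd_mat_iff_psd_on)
    then obtain A where A: "\<And>p r. p < N \<Longrightarrow> r < N \<Longrightarrow> P p r = (\<Sum>l<N. A p l * cnj (A r l))"
      using psd_on_gram_exists[of "{..<N}" P] by auto
    define z where "z p = q (x (i p))" for p
    \<comment> \<open>Dividing the Gram vectors by the weight removes G from the Pick matrix and
      leaves the condition for the Szego kernel of the disc.\<close>
    have gram: "(1 - z p * cnj (z r)) * (\<Sum>l<N. (A p l / G (x (i p))) * cnj (A r l / G (x (i r))))
      = (if \<sigma> p = \<sigma> r then 1 else 0) - (\<Sum>t<n. W (i p) $$ (\<sigma> p, t) * cnj (W (i r) $$ (\<sigma> r, t)))"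
      if "p < N" "r < N" for p r
    proof -
      have nz: "G (x (i p)) \<noteq> 0" "G (x (i r)) \<noteq> 0" "1 - z p * cnj (z r) \<noteq> 0"
        using G_nonzero x\<Omega> that q_prod[of "x (i p)" "x (i r)"] by (auto simp: z_def)
      have "(\<Sum>l<N. (A p l / G (x (i p))) * cnj (A r l / G (x (i r)))) = P p r / (G (x (i p)) * cnj (G (x (i r))))"
        by (simp add: A[OF that] sum_divide_distrib)
      then show ?thesis
        using nz by (simp add: P_def K x\<Omega> that z_def[symmetric])
    qed
    have "cmod (z p) < 1" if "p < N" for p
      using q_less[OF x\<Omega>[OF that]] by (simp add: z_def)
    then obtain A' B C D where sys: "contractive_system N m n A' B C D"
      and interp: "\<And>p t. p < N \<Longrightarrow> t < n \<Longrightarrow>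
        contractive_system.transfer N n A' B C D (z p) (\<sigma> p) t = W (i p) $$ (\<sigma> p, t)"
      using interpolating_system_exists[where N = N and z = z and \<sigma> = \<sigma> and m = m and n = n
          and A = "\<lambda>p l. A p l / G (x (i p))" and W = "\<lambda>p t. W (i p) $$ (\<sigma> p, t)", OF _ \<sigma> gram] by blast
    let ?\<Phi> = "\<lambda>x. Matrix.mat m n (\<lambda>(s, t). contractive_system.transfer N n A' B C D (q x) s t)"
    have "?\<Phi> (x j) = W j" if "j < k" for j
    proof (rule eq_matI)
      fix s t assume st: "s < dim_row (W j)" "t < dim_col (W j)"
      then have st: "s < m" "t < n"
        using W that by auto
      define p where "p = j * m + s"
      have "p < (j + 1) * m"
        using st by (simp add: p_def)
      also have "\<dots> \<le> N"
        using that unfolding N_def by (intro mult_le_mono1) simp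
      finally have "p < N" .
      moreover have "i p = j" "\<sigma> p = s"
        using st by (simp_all add: p_def i_def \<sigma>_def)
      ultimately show "?\<Phi> (x j) $$ (s, t) = W j $$ (s, t)"
        using interp[of p t] st by (simp add: z_def)
    qed (use W that in auto)
    then show "\<exists>\<Phi>. contractive_multiplier \<Omega> hardy_space inner_prod m n \<Phi> \<and> (\<forall>j<k. \<Phi> (x j) = W j)"
      using transfer_contractive_multiplier[OF sys] by blast
  qed
  with psd_kernel rkhs_axioms show ?thesis
    unfolding cnp_kernel_def by blast
qed

end

section \<open>De Branges--Rovnyak spaces on the bidisc with the CNP property\<close>

theorem theorem1p4:
  fixes \<phi> :: "complex \<times> complex \<Rightarrow> complex"
  assumes "\<phi> \<in> H_inf_1_bidisc"
    and "\<not> \<phi> constant_on bidisc"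
  shows "cnp_kernel bidisc (dbr_kernel \<phi>) \<longleftrightarrow>
    (\<exists>\<mu>\<in>ball 0 1. \<exists>c\<in>sphere 0 1. \<exists>pr\<in>{fst, snd}. \<forall>z\<in>bidisc. \<phi> z = c * disc_aut \<mu> (pr z))"
proof
  assume "cnp_kernel bidisc (dbr_kernel \<phi>)"
  with assms show "\<exists>\<mu>\<in>ball 0 1. \<exists>c\<in>sphere 0 1. \<exists>pr\<in>{fst, snd}. \<forall>z\<in>bidisc. \<phi> z = c * disc_aut \<mu> (pr z)"
    by (rule cnp_kernel_imp_coordinate_aut)
next
  assume "\<exists>\<mu>\<in>ball 0 1. \<exists>c\<in>sphere 0 1. \<exists>pr\<in>{fst, snd}. \<forall>z\<in>bidisc. \<phi> z = c * disc_aut \<mu> (pr z)"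
  then obtain \<mu> c pr where "\<mu> \<in> ball 0 1" "c \<in> sphere 0 1" and pr: "pr \<in> {fst, snd}"
    and \<phi>: "\<And>z. z \<in> bidisc \<Longrightarrow> \<phi> z = c * disc_aut \<mu> (pr z)"
    by blast
  then have \<mu>: "cmod \<mu> < 1" and c: "cmod c = 1"
    by simp_all
  \<comment> \<open>\<open>q\<close> is the coordinate on which \<phi> does not depend; its Szego
    denominator is the one that survives.\<close>
  obtain q :: "complex \<times> complex \<Rightarrow> complex" where q: "pr = fst \<and> q = snd \<or> pr = snd \<and> q = fst"
    using pr by auto
  \<comment> \<open>r and the denominator of \<open>G\<close> split the right-hand side of
    \<open>one_minus_disc_aut_mult_cnj\<close> into a rank-one factor and the Szego denominator in
    \<open>pr\<close>.\<close>
  define r where "r = sqrt (1 - (cmod \<mu>)\<^sup>2)"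
  define G where "G z = of_real r / (1 - cnj \<mu> * pr z)" for z
  have pr_less: "cmod (pr z) < 1" if "z \<in> bidisc" for z
    using that pr by (auto simp: bidisc_def)
  have \<mu>2: "(cmod \<mu>)\<^sup>2 < 1"
    using \<mu> by (simp add: abs_square_less_1)
  interpret weighted_hardy bidisc G q
  proof
    show "q ` bidisc = ball 0 1"
      using q by (auto simp: bidisc_def image_iff intro: bexI[of _ 0])
    show "G z \<noteq> 0" if "z \<in> bidisc" for z
      using \<mu>2 one_minus_mult_cnj_nonzero[OF pr_less[OF that] \<mu>] by (simp add: G_def r_def mult.commute)
  qed
  show "cnp_kernel bidisc (dbr_kernel \<phi>)"
  proof (rule cnp_kernel)
    fix z w assume zw: "z \<in> bidisc" "w \<in> bidisc"
    have "\<phi> z * cnj (\<phi> w) = (c * cnj c) * (disc_aut \<mu> (pr z) * cnj (disc_aut \<mu> (pr w)))"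
      by (simp add: \<phi> zw)
    also have "c * cnj c = 1"
      using c complex_norm_square[of c] by simp
    finally have "1 - \<phi> z * cnj (\<phi> w) = 1 - disc_aut \<mu> (pr z) * cnj (disc_aut \<mu> (pr w))"
      by simp
    also have "\<dots> = (1 - \<mu> * cnj \<mu>) * (1 - pr z * cnj (pr w)) / ((1 - pr z * cnj \<mu>) * (1 - \<mu> * cnj (pr w)))"
      by (rule one_minus_disc_aut_mult_cnj[OF \<mu> pr_less[OF zw(1)] pr_less[OF zw(2)]])
    also have "1 - \<mu> * cnj \<mu> = of_real (1 - (cmod \<mu>)\<^sup>2)"
      by (simp only: of_real_diff of_real_1 complex_norm_square)
    also have "1 - (cmod \<mu>)\<^sup>2 = r * r"
      using \<mu>2 by (simp add: r_def)
    finally have num: "1 - \<phi> z * cnj (\<phi> w) = G z * cnj (G w) * (1 - pr z * cnj (pr w))"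
      by (simp add: G_def mult.commute[of "cnj \<mu>" "pr z"])
    have "(1 - fst z * cnj (fst w)) * (1 - snd z * cnj (snd w)) = (1 - pr z * cnj (pr w)) * (1 - q z * cnj (q w))"
      using q by (auto simp: mult.commute)
    then show "dbr_kernel \<phi> z w = G z * cnj (G w) / (1 - q z * cnj (q w))"
      using one_minus_mult_cnj_nonzero[OF pr_less[OF zw(1)] pr_less[OF zw(2)]]
      by (simp add: dbr_kernel_def szego2_def num)
  qed
qed

end
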